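(* The competitive ratio of Budgeted Greedy on exponentially distributed item sizes is $\Omega(\sqrt{\log C})$. This is exhibited by the following hard input for Budgeted Greedy with parameter $\gamma=1$, ties being broken arbitrarily. Let $n_1\ge 1$ be an integer and $\varepsilon\in(0,1)$. Put $\lambda=(1+\varepsilon)\log C$, $\beta=6\frac{n_1\log C}{\varepsilon}$ (with $\beta\ge 2$), $\mu=\beta\log C$, $k=3\varepsilon\mu=18\,n_1(\log C)^2$ (rounding of $k$ to an integer is ignored). Consider the sequence of independent items, consisting of $n_1$ items of rate $\lambda$ and $n_2=kn_1$ items of rate $\mu$, presented in the order \[ X_{1,1}^\mu\cdots X_{1,k}^\mu\,X_1^\lambda\;\;X_{2,1}^\mu\cdots X_{2,k}^\mu\,X_2^\lambda\;\;\cdots\;\;X_{n_1,1}^\mu\cdots X_{n_1,k}^\mu\,X_{n_1}^\lambda, \] where $X_{i,j}^\mu\sim\exp(\mu)$ and $X_i^\lambda\sim\exp(\lambda)$. On this input: (a) $\mathrm{cost}(\mathrm{ALG})\ge \frac12 n_1$, where $\mathrm{ALG}$ is Budgeted Greedy with $\gamma=1$; (b) if $\varepsilon\log C\ge 4$, then \[ \mathrm{cost}(\mathrm{OPT})\le 48\,n_1\left(\frac{k}{\beta\log C}+\frac{1}{\varepsilon\log C}\right)=48\,n_1\left(3\varepsilon+\frac{1}{\varepsilon\log C}\right). \] Consequently, taking $\varepsilon=\sqrt{\frac{1}{3\log C}}$, which does not depend on $n_1$ (so that the result scales to any input size), one has $\mathrm{cost}(\mathrm{ALG})\ge\frac12 n_1$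 and $\mathrm{cost}(\mathrm{OPT})\le \mathcal{O}\left(1/\sqrt{\log C}\right)n_1$, so that Budgeted Greedy's cost is $\Omega(\sqrt{\log C})$ times the optimal cost.
   Context: Notation. $\log$ is the natural logarithm, and $X\sim\exp(\nu)$ means $\Pr(X>x)=e^{-\nu x}$ for all $x\ge0$ (rate $\nu>0$). Model. $C\ge 1$ is a penalty parameter. The items are independent nonnegative random variables $X_1,\dots,X_n$, packed sequentially in this order into unit-capacity bins. At round $i$ a (deterministic) policy chooses the bin for item $i$ as a function of the history (the bins chosen for, and the realized sizes of, items $1,\dots,i-1$); only afterwards is the size of $X_i$ revealed. The usage $S_j^{i-1}$ of bin $j$ is the sum of the realized sizes of the items among $1,\dots,i-1$ packed into it. A bin is overflowed once its usage exceeds $1$; an overflowed bin is never used again. A bin is opened when it receives its first item. For a policy $\mathcal{P}$, $N_{\mathcal{P}}$ is the number of bins opened, $O_{\mathcal{P}}$ the number of bins overflowed, and $\mathrm{cost}(\mathcal{P})=\mathbf{E}[N_{\mathcal{P}}]+C\,\mathbf{E}[O_{\mathcal{P}}]$. $\mathrm{OPT}$ is a policy of minimum cost among all policies, which may know $n$ and all the distributions (but not the outcomes) in advance; if no minimizer exists, it is an arbitrarily good approximation of the infimum. The competitive ratio compares $\mathrm{cost}(\mathrm{ALG})$ with $\mathrm{cost}(\mathrm{OPT})$. Budgeted Greedy with parameter $\gamma\ge1$ is the following online algorithm. It keeps for each open bin $j$ its usage $S_j^{i-1}$ and its accumulated risk $r_j^{i-1}$. Write $p_i(s)=\Pr(X_i+s>1)$.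 When item $i$ arrives, if there is an open, non-overflowed bin $j$ with $r_j^{i-1}+p_i(S_j^{i-1})\le\gamma/C$, item $i$ is packed into such a bin, ties being broken arbitrarily, and $r_j^i=r_j^{i-1}+p_i(S_j^{i-1})$; otherwise a new bin $k'$ is opened for item $i$, with $r_{k'}^i=p_i(0)$. The risks of the other bins do not change.
   Formalization: Ties are broken by one suitable fixed rule, not every rule (First Fit violates (a)); (b) reads cost(OPT) ≤ max(3, printed bound), since OPT opens at least one bin; the "Consequently" bounds assume n_1 ≥ √(log C); k is rounded up or down. *)

theory Defs
  imports "HOL-Probability.Probability"
begin

section \<open>Packing with overflow\<close>

text \<open>
  A history lists, for the rounds played so far, the label of the bin that was chosen and the
  realized size of the item.  Bin labels carry no meaning; a bin is opened when its label is used
  for the first time.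
\<close>

type_synonym history = "(nat \<times> real) list"
type_synonym policy = "history \<Rightarrow> nat"

definition opened :: "history \<Rightarrow> nat set" where
  "opened h = fst ` set h"

definition usage :: "history \<Rightarrow> nat \<Rightarrow> real" where
  "usage h j = (\<Sum>e\<leftarrow>filter (\<lambda>e. fst e = j) h. snd e)"

definition overflowed :: "history \<Rightarrow> nat set" where
  "overflowed h = {j \<in> opened h. usage h j > 1}"

text \<open>The history after \<open>i\<close> rounds of policy \<open>P\<close> when item \<open>m\<close> (counted from 0) has size \<open>x m\<close>.\<close>

primrec run :: "policy \<Rightarrow> (nat \<Rightarrow> real) \<Rightarrow> nat \<Rightarrow> history" where
  "run P x 0 = []"
| "run P x (Suc i) = run P x i @ [(P (run P x i), x i)]"

text \<open>
  The expected cost of a policy only makes sense if its decisions depend measurably on the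
  observed sizes.
\<close>

definition measurable_policy :: "policy \<Rightarrow> bool" where
  "measurable_policy P \<longleftrightarrow>
     (\<forall>i b. (\<lambda>x. P (map (\<lambda>m. (b m, x m)) [0..<i]))
              \<in> measurable (Pi\<^sub>M {..<i} (\<lambda>_. borel :: real measure)) (count_space UNIV))"

definition policies :: "nat \<Rightarrow> policy set" where
  "policies n = {P. measurable_policy P \<and>
     (\<forall>x. (\<forall>i. 0 \<le> x i) \<longrightarrow> (\<forall>i<n. P (run P x i) \<notin> overflowed (run P x i)))}"

text \<open>
  An input is the list of the distributions of its items; the items are the coordinates of the
  product space, hence independent.
\<close>

type_synonym input = "real measure list"

definition item_space :: "input \<Rightarrow> (nat \<Rightarrow> real) measure" where
  "item_space D = Pi\<^sub>M {..<length D} (\<lambda>i. D ! i)"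

definition cost :: "real \<Rightarrow> input \<Rightarrow> policy \<Rightarrow> real" where
  "cost C D P =
     (\<integral>x. real (card (opened (run P x (length D)))) \<partial>item_space D) +
     C * (\<integral>x. real (card (overflowed (run P x (length D)))) \<partial>item_space D)"

definition opt_cost :: "real \<Rightarrow> input \<Rightarrow> real" where
  "opt_cost C D = (INF P\<in>policies (length D). cost C D P)"

definition competitive_ratio :: "real \<Rightarrow> input set \<Rightarrow> (input \<Rightarrow> policy) \<Rightarrow> ereal" where
  "competitive_ratio C \<I> alg = (SUP D\<in>\<I>. ereal (cost C D (alg D) / opt_cost C D))"


section \<open>Budgeted Greedy\<close>

definition overflow_prob :: "real measure \<Rightarrow> real \<Rightarrow> real" where
  "overflow_prob d s = measure d {x \<in> space d. x + s > 1}"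

text \<open>
  The summand of the item that opens bin \<open>j\<close> is its overflow probability in an empty bin, because
  \<open>j\<close> has usage 0 before that round.
\<close>

definition risk :: "input \<Rightarrow> history \<Rightarrow> nat \<Rightarrow> real" where
  "risk D h j =
     (\<Sum>i | i < length h \<and> fst (h ! i) = j. overflow_prob (D ! i) (usage (take i h) j))"

definition admissible :: "real \<Rightarrow> real \<Rightarrow> input \<Rightarrow> history \<Rightarrow> nat set" where
  "admissible \<gamma> C D h =
     {j \<in> opened h - overflowed h.
        risk D h j + overflow_prob (D ! length h) (usage h j) \<le> \<gamma> / C}"

text \<open>A tie-breaking rule sees the history and the set of bins it may choose from.\<close>

definition tie_breaking :: "(history \<Rightarrow> nat set \<Rightarrow> nat) \<Rightarrow> bool" where
  "tie_breaking t \<longleftrightarrow>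
     (\<forall>h A. finite A \<longrightarrow> A \<noteq> {} \<longrightarrow> t h A \<in> A) \<and>
     (\<forall>A. finite A \<longrightarrow> measurable_policy (\<lambda>h. t h A))"

definition budgeted_greedy ::
    "(history \<Rightarrow> nat set \<Rightarrow> nat) \<Rightarrow> real \<Rightarrow> real \<Rightarrow> input \<Rightarrow> policy" where
  "budgeted_greedy t \<gamma> C D h =
     (if admissible \<gamma> C D h = {} then (LEAST j. j \<notin> opened h)
      else t h (admissible \<gamma> C D h))"


section \<open>Exponential inputs and the hard input\<close>

definition exponential_input :: "real list \<Rightarrow> input" where
  "exponential_input \<nu>s = map (\<lambda>\<nu>. density lborel (exponential_density \<nu>)) \<nu>s"

definition exponential_inputs :: "input set" where
  "exponential_inputs = {exponential_input \<nu>s | \<nu>s. \<nu>s \<noteq> [] \<and> (\<forall>\<nu>\<in>set \<nu>s. 0 < \<nu>)}"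

definition hard_lambda :: "real \<Rightarrow> real \<Rightarrow> real" where
  "hard_lambda C \<epsilon> = (1 + \<epsilon>) * ln C"

definition hard_beta :: "real \<Rightarrow> real \<Rightarrow> nat \<Rightarrow> real" where
  "hard_beta C \<epsilon> n1 = 6 * (real n1 * ln C / \<epsilon>)"

definition hard_mu :: "real \<Rightarrow> real \<Rightarrow> nat \<Rightarrow> real" where
  "hard_mu C \<epsilon> n1 = hard_beta C \<epsilon> n1 * ln C"

text \<open>
  The number of items of rate \<open>\<mu>\<close> per block is a natural number \<open>k\<close> obtained by rounding the real
  number \<open>hard_k\<close>, in either direction.
\<close>

definition hard_k :: "real \<Rightarrow> real \<Rightarrow> nat \<Rightarrow> real" where
  "hard_k C \<epsilon> n1 = 3 * \<epsilon> * hard_mu C \<epsilon> n1"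

definition is_rounding :: "nat \<Rightarrow> real \<Rightarrow> bool" where
  "is_rounding k r \<longleftrightarrow> int k = \<lfloor>r\<rfloor> \<or> int k = \<lceil>r\<rceil>"

definition hard_input :: "real \<Rightarrow> real \<Rightarrow> nat \<Rightarrow> nat \<Rightarrow> input" where
  "hard_input C \<epsilon> n1 k = exponential_input
     (concat (replicate n1 (replicate k (hard_mu C \<epsilon> n1) @ [hard_lambda C \<epsilon>])))"

end

theory Submission
  imports Defs
begin

text \<open>
  Call the items of rate \<open>\<lambda> = (1 + \<epsilon>) * ln C\<close> slow and those of rate \<open>\<mu>\<close> fast.  A slow item
  has overflow probability \<open>exp (- \<lambda> * (1 - s))\<close> in a bin with usage \<open>s\<close>, and this is within the
  budget \<open>1 / C\<close> only for \<open>s \<le> \<epsilon> / (1 + \<epsilon>)\<close>.  The tiny fast items run no risk worth mentioning, so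
  Budgeted Greedy mixes them with the slow ones, and the roughly \<open>3 * \<epsilon>\<close> that a block of fast items
  occupies suffices to exclude the next slow item from the bin.

  For the lower bound, ties are broken in favour of the newest bin.  Since slow items are the riskiest
  ones, a bin that rejects any item rejects all later slow items, so only the newest bin can ever accept
  a slow item.  Hence, if a block opens no bin, its fast items and the slow item before it all lie in
  the newest bin and have total size at most \<open>\<epsilon> / (1 + \<epsilon>)\<close> (\<open>block_fits_if_no_bin_opened\<close>); this
  happens with probability at most \<open>1 / 2\<close> (\<open>hard_block_prob\<close>).

  For the upper bound, items are packed by rate, and a bin for rate \<open>\<nu>\<close> is closed when its usage
  exceeds \<open>1 - ln C / \<nu>\<close>.  By memorylessness the item that closes a bin overflows it with probability
  exactly \<open>1 / C\<close>, so on average each closed bin costs 2.  The number of closed bins is bounded by total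
  size over threshold, which gives \<open>2 / (\<nu> - ln C)\<close> per item, plus one unfinished bin per rate
  (\<open>cost_rate_policy_le\<close>).  A slow item thus costs \<open>2 / (\<epsilon> * ln C)\<close> and a block of fast items about
  \<open>6 * \<epsilon>\<close>.  With \<open>\<epsilon>\<close> of order \<open>1 / sqrt (ln C)\<close> both are of this order, against a cost of at
  least \<open>1 / 2\<close> per slow item for Budgeted Greedy.
\<close>

section \<open>Histories and runs\<close>

lemma opened_append [simp]: "opened (h @ [(b, y)]) = insert b (opened h)"
  by (auto simp: opened_def)

lemma usage_append: "usage (h @ [(b, y)]) j = usage h j + (if j = b then y else 0)"
  by (auto simp: usage_def)

lemma usage_not_opened: "j \<notin> opened h \<Longrightarrow> usage h j = 0"
  unfolding usage_def opened_def by (subst filter_False) (auto simp: image_iff)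

lemma finite_opened [simp]: "finite (opened h)"
  by (simp add: opened_def)

lemma length_run [simp]: "length (run P x i) = i"
  by (induction i) auto

lemma nth_run: "m < i \<Longrightarrow> run P x i ! m = (P (run P x m), x m)"
  by (induction i) (auto simp: nth_append less_Suc_eq)

lemma run_cong: "(\<And>m. m < i \<Longrightarrow> x m = y m) \<Longrightarrow> run P x i = run P y i"
  by (induction i) auto

lemma card_opened_run_le: "card (opened (run P x i)) \<le> i"
  unfolding opened_def using card_image_le[of "set (run P x i)" fst] card_length[of "run P x i"] by simp

lemma usage_run_nonneg:
  assumes "\<And>m. 0 \<le> x m"
  shows "0 \<le> usage (run P x i) j"
  by (induction i) (auto simp: usage_append assms, simp add: usage_def)

lemma opened_map: "opened (map (\<lambda>m. (b m, x m)) [0..<i]) = b ` {..<i}"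
  by (simp add: opened_def image_image lessThan_atLeast0)

lemma usage_map:
  "usage (map (\<lambda>m. (b m, x m)) [0..<i]) j = (\<Sum>m<i. if b m = j then x m else 0)"
proof (induction i)
  case 0
  then show ?case by (simp add: usage_def)
next
  case (Suc i)
  have "map (\<lambda>m. (b m, x m)) [0..<Suc i] = map (\<lambda>m. (b m, x m)) [0..<i] @ [(b i, x i)]" by simp
  then show ?case using Suc by (simp add: usage_append)
qed

lemma run_eq_map: "run P x i = map (\<lambda>m. (map fst (run P x i) ! m, x m)) [0..<i]"
  by (rule nth_equalityI) (auto simp: nth_run)

section \<open>Measurability of runs\<close>

abbreviation sizes :: "nat \<Rightarrow> (nat \<Rightarrow> real) measure" where
  "sizes n \<equiv> Pi\<^sub>M {..<n} (\<lambda>_. borel)"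

text \<open>
  Only the decisions of the first \<open>n\<close> rounds matter on an input of length \<open>n\<close>.  This weakening of
  \<^const>\<open>measurable_policy\<close> is what Budgeted Greedy satisfies: past the end of the input its
  decisions refer to distributions that do not exist.
\<close>

definition adapted :: "nat \<Rightarrow> policy \<Rightarrow> bool" where
  "adapted n P \<longleftrightarrow> (\<forall>i<n. \<forall>b. (\<lambda>x. P (map (\<lambda>m. (b m, x m)) [0..<i])) \<in> sizes n \<rightarrow>\<^sub>M count_space UNIV)"

lemma measurable_policy_adapted:
  assumes "measurable_policy P"
  shows "adapted n P"
  unfolding adapted_def
proof (intro allI impI)
  fix i b assume i: "i < n"
  have "(\<lambda>x. P (map (\<lambda>m. (b m, x m)) [0..<i])) \<in> sizes i \<rightarrow>\<^sub>M count_space UNIV"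
    using assms by (auto simp: measurable_policy_def)
  moreover have "(\<lambda>x. restrict x {..<i}) \<in> sizes n \<rightarrow>\<^sub>M sizes i"
    using i by (intro measurable_restrict_subset) auto
  ultimately have "(\<lambda>x. P (map (\<lambda>m. (b m, restrict x {..<i} m)) [0..<i])) \<in> sizes n \<rightarrow>\<^sub>M count_space UNIV"
    by (rule measurable_compose[rotated])
  moreover have "map (\<lambda>m. (b m, restrict x {..<i} m)) [0..<i] = map (\<lambda>m. (b m, x m)) [0..<i]" for x :: "nat \<Rightarrow> real"
    by simp
  ultimately show "(\<lambda>x. P (map (\<lambda>m. (b m, x m)) [0..<i])) \<in> sizes n \<rightarrow>\<^sub>M count_space UNIV"
    by (simp only:)
qed

lemma measurable_bins:
  assumes "adapted n P" "i \<le> n"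
  shows "(\<lambda>x. map fst (run P x i)) \<in> sizes n \<rightarrow>\<^sub>M count_space UNIV"
  using assms(2)
proof (induction i)
  case (Suc i)
  then have IH: "(\<lambda>x. map fst (run P x i)) \<in> sizes n \<rightarrow>\<^sub>M count_space UNIV" by simp
  have *: "map fst (run P x (Suc i)) = (\<lambda>bs. bs @ [P (map (\<lambda>m. (bs ! m, x m)) [0..<i])]) (map fst (run P x i))" for x
    using run_eq_map[of P x i] by simp
  show ?case unfolding *
  proof (rule measurable_compose_countable[OF _ IH])
    fix bs :: "nat list"
    have "(\<lambda>x. P (map (\<lambda>m. (bs ! m, x m)) [0..<i])) \<in> sizes n \<rightarrow>\<^sub>M count_space UNIV"
      using assms(1) Suc.prems by (auto simp: adapted_def)
    then show "(\<lambda>x. bs @ [P (map (\<lambda>m. (bs ! m, x m)) [0..<i])]) \<in> sizes n \<rightarrow>\<^sub>M count_space UNIV"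
      by (rule measurable_compose) simp
  qed
qed simp

text \<open>
  A policy whose decisions depend measurably on the sizes produces one of countably many sequences
  of bins, and for a fixed sequence of bins the history is an explicit function of the sizes.  So
  measurability of a functional of the random history can be checked for fixed bins.
\<close>

lemma measurable_run:
  assumes "adapted n P" "i \<le> n"
    and "\<And>b. (\<lambda>x. G (map (\<lambda>m. (b m, x m)) [0..<i])) \<in> sizes n \<rightarrow>\<^sub>M N"
  shows "(\<lambda>x. G (run P x i)) \<in> sizes n \<rightarrow>\<^sub>M N"
proof -
  have *: "G (run P x i) = (\<lambda>bs. G (map (\<lambda>m. (bs ! m, x m)) [0..<i])) (map fst (run P x i))" for x
    using run_eq_map[of P x i] by simp
  show ?thesis unfolding *
    by (rule measurable_compose_countable[OF _ measurable_bins[OF assms(1,2)]]) (rule assms(3))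
qed

lemma measurable_usage_map:
  assumes "i \<le> n"
  shows "(\<lambda>x. usage (map (\<lambda>m. (b m, x m)) [0..<i]) j) \<in> borel_measurable (sizes n)"
  unfolding usage_map
proof (intro borel_measurable_sum)
  fix m assume "m \<in> {..<i}"
  with assms have [measurable]: "(\<lambda>x. x m) \<in> borel_measurable (sizes n)"
    by (intro measurable_component_singleton) auto
  show "(\<lambda>x. if b m = j then x m else 0) \<in> borel_measurable (sizes n)"
    by measurable
qed

lemma measurable_card_opened:
  assumes "adapted n P" "i \<le> n"
  shows "(\<lambda>x. real (card (opened (run P x i)))) \<in> borel_measurable (sizes n)"
  by (rule measurable_run[OF assms, where G = "\<lambda>h. real (card (opened h))"]) (simp add: opened_map)

text \<open>
  Both policies below choose a bin as a function of the set of bins that pass some test.  For fixed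
  bins in the history this is a random subset of a fixed finite set.
\<close>

lemma measurable_choice:
  assumes "finite J" and [measurable]: "\<And>j. j \<in> J \<Longrightarrow> Measurable.pred M (\<lambda>x. Q x j)"
  shows "(\<lambda>x. F {j \<in> J. Q x j}) \<in> M \<rightarrow>\<^sub>M count_space UNIV"
proof (rule measurable_compose[where N = "count_space (Pow J)"])
  show "(\<lambda>x. {j \<in> J. Q x j}) \<in> M \<rightarrow>\<^sub>M count_space (Pow J)"
  proof (subst measurable_count_space_eq2, use assms(1) in simp, intro conjI ballI)
    fix a assume a: "a \<in> Pow J"
    have "(\<lambda>x. {j \<in> J. Q x j}) -` {a} \<inter> space M = {x \<in> space M. \<forall>j\<in>J. Q x j = (j \<in> a)}"
      using a by auto
    also have "\<dots> \<in> sets M"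
      using assms(1) by measurable
    finally show "(\<lambda>x. {j \<in> J. Q x j}) -` {a} \<inter> space M \<in> sets M" .
  qed auto
qed simp

section \<open>Exponential sizes\<close>

abbreviation expm :: "real \<Rightarrow> real measure" where
  "expm \<nu> \<equiv> density lborel (exponential_density \<nu>)"

lemma distributed_expm:
  assumes "0 < \<nu>"
  shows "distributed (expm \<nu>) lborel (\<lambda>x. x) (exponential_density \<nu>)"
proof -
  have "distr (expm \<nu>) lborel (\<lambda>x. x) = expm \<nu>"
    by (rule distr_id2) simp
  then show ?thesis using assms by (simp add: distributed_def exponential_density_nonneg)
qed

lemma measure_expm_gt:
  assumes "0 < \<nu>" "0 \<le> a"
  shows "measure (expm \<nu>) {x. a < x} = exp (- \<nu> * a)"
proof -
  interpret prob_space "expm \<nu>" by (rule prob_space_exponential_density) fact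
  show ?thesis
    using exponential_distributedD_gt[OF distributed_expm[OF assms(1)] assms(2,1)]
    by (simp add: mult.commute)
qed

lemma emeasure_expm_gt:
  assumes "0 < \<nu>" "0 \<le> a"
  shows "emeasure (expm \<nu>) {x. a < x} = ennreal (exp (- \<nu> * a))"
proof -
  interpret prob_space "expm \<nu>" by (rule prob_space_exponential_density) fact
  show ?thesis using measure_expm_gt[OF assms] by (simp add: emeasure_eq_measure)
qed

lemma AE_expm_nonneg: "0 < \<nu> \<Longrightarrow> AE x in expm \<nu>. 0 \<le> x"
  by (subst AE_density) (auto simp: exponential_density_def)

lemma overflow_prob_nonneg: "0 \<le> overflow_prob d s"
  by (simp add: overflow_prob_def)

lemma overflow_prob_expm:
  assumes "0 < \<nu>"
  shows "overflow_prob (expm \<nu>) s = (if s \<le> 1 then exp (- \<nu> * (1 - s)) else 1)"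
proof -
  interpret prob_space "expm \<nu>" by (rule prob_space_exponential_density) fact
  have *: "{x \<in> space (expm \<nu>). x + s > 1} = {x. 1 - s < x}" by auto
  show ?thesis
  proof (cases "s \<le> 1")
    case True
    then show ?thesis using measure_expm_gt[OF assms, of "1 - s"] unfolding overflow_prob_def * by simp
  next
    case False
    have "AE x in expm \<nu>. 1 - s < x"
      using AE_expm_nonneg[OF assms] by (rule eventually_mono) (use False in simp)
    then have "prob {x \<in> space (expm \<nu>). 1 - s < x} = 1"
      by (intro prob_eq_1[THEN iffD2]) auto
    then show ?thesis using False unfolding overflow_prob_def * by simp
  qed
qed

text \<open>
  A slower item in a fuller bin is at least as risky; that faster items are never riskier than slow
  ones is what keeps closed bins closed in the analysis of Budgeted Greedy.
\<close>

lemma overflow_prob_expm_mono: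
  assumes "0 < \<kappa>" "\<kappa> \<le> \<nu>" "s \<le> s'"
  shows "overflow_prob (expm \<nu>) s \<le> overflow_prob (expm \<kappa>) s'"
proof (cases "s' \<le> 1")
  case True
  then have "\<kappa> * (1 - s') \<le> \<nu> * (1 - s)" using assms by (intro mult_mono) auto
  then show ?thesis using assms True by (auto simp: overflow_prob_expm)
next
  case False
  then show ?thesis using assms by (auto simp: overflow_prob_expm)
qed

lemma borel_measurable_overflow_prob_expm:
  assumes "0 < \<nu>"
  shows "overflow_prob (expm \<nu>) \<in> borel_measurable borel"
  by (intro borel_measurable_mono monoI overflow_prob_expm_mono assms order_refl)

lemma nn_integral_expm_exp:
  assumes "0 < \<nu>"
  shows "(\<integral>\<^sup>+x. ennreal (exp (- \<nu> * x)) \<partial>expm \<nu>) = ennreal (1 / 2)"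
proof -
  interpret prob_space "expm (2 * \<nu>)" using assms by (intro prob_space_exponential_density) simp
  have "(\<integral>\<^sup>+x. ennreal (exp (- \<nu> * x)) \<partial>expm \<nu>) =
      (\<integral>\<^sup>+x. ennreal (exponential_density \<nu> x) * ennreal (exp (- \<nu> * x)) \<partial>lborel)"
    by (subst nn_integral_density) auto
  also have "\<dots> = (\<integral>\<^sup>+x. ennreal (1 / 2) * ennreal (exponential_density (2 * \<nu>) x) \<partial>lborel)"
  proof (rule nn_integral_cong)
    fix x
    have "exponential_density \<nu> x * exp (- \<nu> * x) = 1 / 2 * exponential_density (2 * \<nu>) x"
      by (auto simp: exponential_density_def exp_add[symmetric] algebra_simps)
    then show "ennreal (exponential_density \<nu> x) * ennreal (exp (- \<nu> * x)) =
        ennreal (1 / 2) * ennreal (exponential_density (2 * \<nu>) x)"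
      by (simp only: ennreal_mult''[symmetric] exp_ge_zero ennreal_mult'[symmetric] zero_le_divide_1_iff zero_le_numeral)
  qed
  also have "\<dots> = ennreal (1 / 2) * (\<integral>\<^sup>+x. ennreal (exponential_density (2 * \<nu>) x) \<partial>lborel)"
    by (rule nn_integral_cmult) simp
  also have "(\<integral>\<^sup>+x. ennreal (exponential_density (2 * \<nu>) x) \<partial>lborel) = emeasure (expm (2 * \<nu>)) UNIV"
    by (simp add: emeasure_density)
  also have "\<dots> = 1" using emeasure_space_1 by simp
  finally show ?thesis by simp
qed

lemma nn_integral_expm_id:
  assumes "0 < \<nu>"
  shows "(\<integral>\<^sup>+x. ennreal x \<partial>expm \<nu>) = ennreal (1 / \<nu>)"
proof -
  have "(\<integral>\<^sup>+x. ennreal x \<partial>expm \<nu>) = (\<integral>\<^sup>+x. ennreal (exponential_density \<nu> x) * ennreal x \<partial>lborel)"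
    by (subst nn_integral_density) auto
  also have "\<dots> = (\<integral>\<^sup>+x. ennreal (erlang_density 0 \<nu> x * x ^ 1) \<partial>lborel)"
    by (intro nn_integral_cong) (auto simp: ennreal_mult'[symmetric] ennreal_mult''[symmetric] exponential_density_nonneg assms)
  also have "\<dots> = ennreal (1 / \<nu>)"
    using assms nn_integral_erlang_ith_moment[of \<nu> 0 1] by simp
  finally show ?thesis .
qed

abbreviation exp_sizes :: "(nat \<Rightarrow> real) \<Rightarrow> nat \<Rightarrow> (nat \<Rightarrow> real) measure" where
  "exp_sizes rate n \<equiv> Pi\<^sub>M {..<n} (\<lambda>i. expm (rate i))"

abbreviation exp_input :: "(nat \<Rightarrow> real) \<Rightarrow> nat \<Rightarrow> input" where
  "exp_input rate n \<equiv> exponential_input (map rate [0..<n])"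

lemma length_exp_input [simp]: "length (exp_input rate n) = n"
  by (simp add: exponential_input_def)

lemma nth_exp_input [simp]: "i < n \<Longrightarrow> exp_input rate n ! i = expm (rate i)"
  by (simp add: exponential_input_def)

lemma item_space_exp_input: "item_space (exp_input rate n) = exp_sizes rate n"
  unfolding item_space_def by (intro PiM_cong) auto

lemma measurable_exp_sizes:
  "measurable (exp_sizes rate n) N = measurable (sizes n) N"
  by (intro measurable_cong_sets sets_PiM_cong) auto

lemma prob_space_exp_sizes: "(\<And>i. 0 < rate i) \<Longrightarrow> prob_space (exp_sizes rate n)"
  by (intro prob_space_PiM prob_space_exponential_density)

lemma AE_exp_sizes_nonneg:
  assumes "\<And>i. 0 < rate i"
  shows "AE x in exp_sizes rate n. \<forall>i<n. 0 \<le> x i"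
proof -
  have "AE x in exp_sizes rate n. \<forall>i\<in>{..<n}. 0 \<le> x i"
    using assms by (intro AE_finite_allI AE_PiM_component AE_expm_nonneg prob_space_exponential_density) auto
  then show ?thesis by eventually_elim auto
qed

lemma nn_integral_exp_sizes_component:
  assumes "\<And>i. 0 < rate i" "i < n" "f \<in> borel_measurable borel"
  shows "(\<integral>\<^sup>+x. f (x i) \<partial>exp_sizes rate n) = (\<integral>\<^sup>+y. f y \<partial>expm (rate i))"
proof -
  have "distr (exp_sizes rate n) (expm (rate i)) (\<lambda>x. x i) = expm (rate i)"
    by (rule distr_PiM_component) (use assms in \<open>auto intro: prob_space_exponential_density\<close>)
  then have "(\<integral>\<^sup>+y. f y \<partial>expm (rate i)) = (\<integral>\<^sup>+y. f y \<partial>distr (exp_sizes rate n) (expm (rate i)) (\<lambda>x. x i))"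
    by simp
  also have "\<dots> = (\<integral>\<^sup>+x. f (x i) \<partial>exp_sizes rate n)"
    by (subst nn_integral_distr) (use assms in \<open>auto intro!: measurable_component_singleton\<close>)
  finally show ?thesis ..
qed

text \<open>
  Memorylessness, for an item \<open>i\<close> that meets a level \<open>s\<close> determined by the other items: given that
  \<open>s + x i\<close> exceeds \<open>a\<close>, the excess is again exponential with the same rate, so it exceeds
  \<open>b - a\<close> with probability \<open>exp (- rate i * (b - a))\<close>.  The proof integrates over the \<open>i\<close>-th coordinate
  first.
\<close>

lemma memoryless_crossing:
  fixes s :: "(nat \<Rightarrow> real) \<Rightarrow> real"
  assumes pos: "\<And>i. 0 < rate i" and i: "i < n"
    and s: "s \<in> borel_measurable (sizes n)" and s_upd: "\<And>x y. s (x(i := y)) = s x"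
    and ab: "a \<le> b"
  shows "measure (exp_sizes rate n) {x \<in> space (exp_sizes rate n). s x \<le> a \<and> b < s x + x i} =
    exp (- rate i * (b - a)) * measure (exp_sizes rate n) {x \<in> space (exp_sizes rate n). s x \<le> a \<and> a < s x + x i}"
proof -
  let ?M = "exp_sizes rate n"
  let ?A = "\<lambda>c. {x \<in> space ?M. s x \<le> a \<and> c < s x + x i}"
  let ?I = "{..<n} - {i}"
  let ?c = "ennreal (exp (- rate i * (b - a)))"
  interpret product_sigma_finite "\<lambda>i. expm (rate i)"
    unfolding product_sigma_finite_def using prob_space_exponential_density[OF pos]
    by (auto intro: prob_space_imp_sigma_finite)
  interpret prob_space ?M by (rule prob_space_exp_sizes) (rule pos)
  have [measurable]: "s \<in> borel_measurable ?M" using s by (simp add: measurable_exp_sizes)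
  have [measurable]: "(\<lambda>x. x i) \<in> borel_measurable ?M"
    unfolding measurable_exp_sizes using i by (intro measurable_component_singleton) auto
  have A [measurable]: "?A c \<in> sets ?M" for c by measurable
  have ins: "insert i ?I = {..<n}" using i by auto
  have fold: "(\<integral>\<^sup>+x. f x \<partial>?M) = (\<integral>\<^sup>+x. \<integral>\<^sup>+y. f (x(i := y)) \<partial>expm (rate i) \<partial>Pi\<^sub>M ?I (\<lambda>i. expm (rate i)))"
    if "f \<in> borel_measurable ?M" for f
    using product_nn_integral_insert[of ?I i f] that ins by simp
  have upd: "x(i := y) \<in> space ?M" if "x \<in> space (Pi\<^sub>M ?I (\<lambda>i. expm (rate i)))" for x y
    using that i by (auto simp: space_PiM PiE_iff extensional_def)
  have inner: "(\<integral>\<^sup>+y. indicator (?A c) (x(i := y)) \<partial>expm (rate i)) =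
      (if s x \<le> a then ennreal (exp (- rate i * (c - s x))) else 0)"
    if x: "x \<in> space (Pi\<^sub>M ?I (\<lambda>i. expm (rate i)))" and c: "a \<le> c" for x c
  proof -
    have "(\<integral>\<^sup>+y. indicator (?A c) (x(i := y)) \<partial>expm (rate i)) =
        (\<integral>\<^sup>+y. indicator {y. s x \<le> a \<and> c - s x < y} y \<partial>expm (rate i))"
      using upd[OF x] by (intro nn_integral_cong) (auto simp: indicator_def s_upd)
    also have "\<dots> = emeasure (expm (rate i)) {y. s x \<le> a \<and> c - s x < y}"
      by (intro nn_integral_indicator) measurable
    also have "\<dots> = (if s x \<le> a then ennreal (exp (- rate i * (c - s x))) else 0)"
      using emeasure_expm_gt[OF pos, of "c - s x" i] c by auto
    finally show ?thesis .
  qed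
  have "emeasure ?M (?A b) = (\<integral>\<^sup>+x. indicator (?A b) x \<partial>?M)"
    by simp
  also have "\<dots> = (\<integral>\<^sup>+x. \<integral>\<^sup>+y. indicator (?A b) (x(i := y)) \<partial>expm (rate i) \<partial>Pi\<^sub>M ?I (\<lambda>i. expm (rate i)))"
    by (rule fold) simp
  also have "\<dots> = (\<integral>\<^sup>+x. \<integral>\<^sup>+y. ?c * indicator (?A a) (x(i := y)) \<partial>expm (rate i) \<partial>Pi\<^sub>M ?I (\<lambda>i. expm (rate i)))"
  proof (rule nn_integral_cong)
    fix x assume x: "x \<in> space (Pi\<^sub>M ?I (\<lambda>i. expm (rate i)))"
    have "{y. x(i := y) \<in> ?A a} = {y. s x \<le> a \<and> a - s x < y}"
      using upd[OF x] by (auto simp: s_upd)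
    then have meas: "{y. x(i := y) \<in> ?A a} \<in> sets (expm (rate i))" by simp
    have ind: "indicator (?A a) (x(i := y)) = (indicator {y. x(i := y) \<in> ?A a} y :: ennreal)" for y
      by (simp add: indicator_def)
    have "(\<integral>\<^sup>+y. ?c * indicator (?A a) (x(i := y)) \<partial>expm (rate i)) =
        ?c * (\<integral>\<^sup>+y. indicator (?A a) (x(i := y)) \<partial>expm (rate i))"
      unfolding ind by (intro nn_integral_cmult borel_measurable_indicator meas)
    also have "\<dots> = (\<integral>\<^sup>+y. indicator (?A b) (x(i := y)) \<partial>expm (rate i))"
      unfolding inner[OF x ab] inner[OF x order_refl]
      by (auto simp: ennreal_mult'[symmetric] exp_add[symmetric] algebra_simps)
    finally show "(\<integral>\<^sup>+y. indicator (?A b) (x(i := y)) \<partial>expm (rate i)) =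
        (\<integral>\<^sup>+y. ?c * indicator (?A a) (x(i := y)) \<partial>expm (rate i))" ..
  qed
  also have "\<dots> = (\<integral>\<^sup>+x. ?c * indicator (?A a) x \<partial>?M)"
    by (rule fold[symmetric]) simp
  also have "\<dots> = ?c * emeasure ?M (?A a)"
    by (simp add: nn_integral_cmult)
  finally show ?thesis
    by (simp add: emeasure_eq_measure ennreal_mult'[symmetric])
qed

lemma measure_exp_sizes_gt:
  assumes "\<And>i. 0 < rate i" "i < n" "0 \<le> a"
  shows "measure (exp_sizes rate n) {x \<in> space (exp_sizes rate n). a < x i} = exp (- rate i * a)"
proof -
  interpret prob_space "exp_sizes rate n" by (rule prob_space_exp_sizes) (rule assms)
  have "(\<lambda>x. x i) \<in> borel_measurable (exp_sizes rate n)"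
    unfolding measurable_exp_sizes using assms by (intro measurable_component_singleton) auto
  note [measurable] = this
  have "emeasure (exp_sizes rate n) {x \<in> space (exp_sizes rate n). a < x i} =
      (\<integral>\<^sup>+x. indicator {x. a < x} (x i) \<partial>exp_sizes rate n)"
  proof -
    have "emeasure (exp_sizes rate n) {x \<in> space (exp_sizes rate n). a < x i} =
        (\<integral>\<^sup>+x. indicator {x \<in> space (exp_sizes rate n). a < x i} x \<partial>exp_sizes rate n)"
      by (rule nn_integral_indicator[symmetric]) measurable
    also have "\<dots> = (\<integral>\<^sup>+x. indicator {x. a < x} (x i) \<partial>exp_sizes rate n)"
      by (intro nn_integral_cong) (simp add: indicator_def)
    finally show ?thesis .
  qed
  also have "\<dots> = emeasure (expm (rate i)) {x. a < x}"
    by (subst nn_integral_exp_sizes_component) (use assms in auto)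
  finally show ?thesis using emeasure_expm_gt[OF assms(1,3), of i] by (simp add: emeasure_eq_measure)
qed

text \<open>
  A Chernoff bound: Markov's inequality for \<open>exp (- \<mu> * S)\<close>, where each of the independent summands
  of \<open>S\<close> contributes a factor \<open>1 / 2\<close>.
\<close>

lemma measure_exp_sizes_sum_le:
  assumes pos: "\<And>i. 0 < rate i" and J: "J \<subseteq> {..<n}" "\<And>i. i \<in> J \<Longrightarrow> rate i = \<mu>" and mu: "0 < \<mu>"
  shows "measure (exp_sizes rate n) {x \<in> space (exp_sizes rate n). (\<Sum>i\<in>J. x i) \<le> a}
    \<le> exp (\<mu> * a) / 2 ^ card J"
proof -
  let ?M = "exp_sizes rate n"
  interpret product_sigma_finite "\<lambda>i. expm (rate i)"
    unfolding product_sigma_finite_def using prob_space_exponential_density[OF pos]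
    by (auto intro: prob_space_imp_sigma_finite)
  interpret prob_space ?M by (rule prob_space_exp_sizes) (rule pos)
  have [simp]: "finite J" using J finite_subset by blast
  have comp: "(\<lambda>x. x i) \<in> borel_measurable ?M" if "i \<in> J" for i
    unfolding measurable_exp_sizes using J that by (intro measurable_component_singleton) auto
  then have [measurable]: "(\<lambda>x. \<Sum>i\<in>J. x i) \<in> borel_measurable ?M" by (intro borel_measurable_sum)
  define f where "f i y = (if i \<in> J then ennreal (exp (- \<mu> * y)) else 1)" for i :: nat and y :: real
  have prodf: "ennreal (exp (- \<mu> * (\<Sum>i\<in>J. x i))) = (\<Prod>i<n. f i (x i))" for x
  proof -
    have "(\<Prod>i<n. f i (x i)) = (\<Prod>i\<in>J. ennreal (exp (- \<mu> * x i)))"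
      using J by (intro prod.mono_neutral_cong_right) (auto simp: f_def)
    also have "\<dots> = ennreal (exp (- \<mu> * (\<Sum>i\<in>J. x i)))"
      by (simp add: prod_ennreal exp_sum sum_distrib_left sum_negf[symmetric])
    finally show ?thesis ..
  qed
  have "emeasure ?M {x \<in> space ?M. (\<Sum>i\<in>J. x i) \<le> a} = (\<integral>\<^sup>+x. indicator {x \<in> space ?M. (\<Sum>i\<in>J. x i) \<le> a} x \<partial>?M)"
    by simp
  also have "\<dots> \<le> (\<integral>\<^sup>+x. ennreal (exp (\<mu> * a)) * ennreal (exp (- \<mu> * (\<Sum>i\<in>J. x i))) \<partial>?M)"
  proof (rule nn_integral_mono)
    fix x
    show "indicator {x \<in> space ?M. (\<Sum>i\<in>J. x i) \<le> a} x \<le> ennreal (exp (\<mu> * a)) * ennreal (exp (- \<mu> * (\<Sum>i\<in>J. x i)))"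
      using mu by (auto simp: indicator_def ennreal_mult'[symmetric] exp_add[symmetric] simp flip: ennreal_1
        intro!: ennreal_leI)
  qed
  also have "\<dots> = ennreal (exp (\<mu> * a)) * (\<integral>\<^sup>+x. (\<Prod>i<n. f i (x i)) \<partial>?M)"
    unfolding prodf[symmetric] by (rule nn_integral_cmult) measurable
  also have "(\<integral>\<^sup>+x. (\<Prod>i<n. f i (x i)) \<partial>?M) = (\<Prod>i<n. integral\<^sup>N (expm (rate i)) (f i))"
    by (rule product_nn_integral_prod) (auto simp: f_def)
  also have "\<dots> = (\<Prod>i<n. if i \<in> J then ennreal (1 / 2) else 1)"
  proof (rule prod.cong[OF refl])
    fix i
    have "f i = (if i \<in> J then \<lambda>y. ennreal (exp (- \<mu> * y)) else (\<lambda>_. 1))" by (auto simp: f_def fun_eq_iff)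
    then show "integral\<^sup>N (expm (rate i)) (f i) = (if i \<in> J then ennreal (1 / 2) else 1)"
      using nn_integral_expm_exp[OF mu] J(2)[of i]
        prob_space.emeasure_space_1[OF prob_space_exponential_density[OF pos, of i]]
      by auto
  qed
  also have "\<dots> = ennreal (1 / 2) ^ card J"
    using J(1) by (simp add: prod.If_cases Int_absorb1)
  also have "\<dots> = ennreal ((1 / 2) ^ card J)"
    by (intro ennreal_power) simp
  finally show ?thesis
    by (simp add: emeasure_eq_measure ennreal_mult'[symmetric] power_divide)
qed

section \<open>A cheap packing of exponential items\<close>

lemma integral_exp_sizes_component:
  assumes pos: "\<And>i. 0 < rate i" and i: "i < n"
  shows "integrable (exp_sizes rate n) (\<lambda>x. x i)" "(\<integral>x. x i \<partial>exp_sizes rate n) = 1 / rate i"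
proof -
  have meas: "(\<lambda>x. x i) \<in> borel_measurable (exp_sizes rate n)"
    unfolding measurable_exp_sizes using i by (intro measurable_component_singleton) auto
  have nonneg: "AE x in exp_sizes rate n. 0 \<le> x i"
    using AE_exp_sizes_nonneg[OF pos, of n] by eventually_elim (use i in auto)
  have "(\<integral>\<^sup>+x. ennreal (x i) \<partial>exp_sizes rate n) = ennreal (1 / rate i)"
    using nn_integral_exp_sizes_component[OF pos i, of ennreal] nn_integral_expm_id[OF pos] by simp
  then have "has_bochner_integral (exp_sizes rate n) (\<lambda>x. x i) (1 / rate i)"
    by (intro has_bochner_integral_nn_integral meas nonneg) (use pos[of i] in auto)
  then show "integrable (exp_sizes rate n) (\<lambda>x. x i)" "(\<integral>x. x i \<partial>exp_sizes rate n) = 1 / rate i"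
    by (auto simp: has_bochner_integral_iff)
qed

lemma integrable_card_opened:
  assumes "\<And>i. 0 < rate i" "adapted n P"
  shows "integrable (exp_sizes rate n) (\<lambda>x. real (card (opened (run P x n))))"
proof -
  interpret prob_space "exp_sizes rate n" by (rule prob_space_exp_sizes) (rule assms)
  show ?thesis
    by (rule integrable_const_bound[where B = "real n"])
      (use assms(2) in \<open>auto simp: card_opened_run_le measurable_exp_sizes intro: measurable_card_opened\<close>)
qed

lemma cost_exp_input_ge:
  assumes "0 \<le> C"
  shows "(\<integral>x. real (card (opened (run P x n))) \<partial>exp_sizes rate n) \<le> cost C (exp_input rate n) P"
  unfolding cost_def length_exp_input item_space_exp_input using assms by simp

text \<open>
  The optimal cost has to be bounded away from 0 for the quotient in the competitive ratio to be
  meaningful, since division by 0 yields 0.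
\<close>

lemma one_le_cost:
  assumes pos: "\<And>i. 0 < rate i" and C: "0 \<le> C" and n: "0 < n" and P: "measurable_policy P"
  shows "1 \<le> cost C (exp_input rate n) P"
proof -
  interpret prob_space "exp_sizes rate n" by (rule prob_space_exp_sizes) (rule pos)
  have "1 \<le> card (opened (run P x n))" for x
  proof -
    obtain m where "n = Suc m" using n gr0_implies_Suc by blast
    then have "opened (run P x n) \<noteq> {}" by simp
    then show ?thesis by (simp add: Suc_le_eq card_gt_0_iff)
  qed
  then have "(\<integral>x. 1 \<partial>exp_sizes rate n) \<le> (\<integral>x. real (card (opened (run P x n))) \<partial>exp_sizes rate n)"
    by (intro integral_mono integrable_card_opened pos measurable_policy_adapted P) auto
  then have "1 \<le> (\<integral>x. real (card (opened (run P x n))) \<partial>exp_sizes rate n)"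
    by (simp add: prob_space)
  also have "\<dots> \<le> cost C (exp_input rate n) P"
    by (rule cost_exp_input_ge[OF C])
  finally show ?thesis .
qed

text \<open>
  If every item is put into a bin whose usage is at most its threshold, then a bin passes its
  threshold at most once, and it does so in the round counted here.
\<close>

lemma real_card_above_run:
  fixes T :: "nat \<Rightarrow> real"
  assumes "\<And>m. m < i \<Longrightarrow> usage (run P x m) (P (run P x m)) \<le> T (P (run P x m))"
  shows "real (card {j \<in> opened (run P x i). T j < usage (run P x i) j}) =
    (\<Sum>m<i. of_bool (T (P (run P x m)) < usage (run P x m) (P (run P x m)) + x m))"
  using assms
proof (induction i)
  case 0
  then show ?case by (simp add: opened_def)
next
  case (Suc i)
  let ?h = "run P x i" and ?b = "P (run P x i)"
  let ?S = "{j \<in> opened ?h. T j < usage ?h j}"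
  have b: "usage ?h ?b \<le> T ?b" using Suc.prems by simp
  have "{j \<in> opened (run P x (Suc i)). T j < usage (run P x (Suc i)) j} =
      (if T ?b < usage ?h ?b + x i then insert ?b ?S else ?S)"
    using b by (auto simp: usage_append)
  moreover have "?b \<notin> ?S" using b by auto
  ultimately show ?case using Suc by simp
qed

lemma sum_usage_run:
  fixes T :: "nat \<Rightarrow> real"
  shows "(\<Sum>j\<in>opened (run P x i). usage (run P x i) j / T j) = (\<Sum>m<i. x m / T (P (run P x m)))"
proof (induction i)
  case 0
  then show ?case by (simp add: opened_def)
next
  case (Suc i)
  let ?h = "run P x i" and ?b = "P (run P x i)"
  have "(\<Sum>j\<in>opened (run P x (Suc i)). usage (run P x (Suc i)) j / T j) =
      (\<Sum>j\<in>insert ?b (opened ?h). usage ?h j / T j + (if j = ?b then x i / T j else 0))"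
    by (auto simp: usage_append add_divide_distrib intro!: sum.cong)
  also have "\<dots> = (\<Sum>j\<in>insert ?b (opened ?h). usage ?h j / T j) + x i / T ?b"
    by (simp add: sum.distrib sum.delta)
  also have "(\<Sum>j\<in>insert ?b (opened ?h). usage ?h j / T j) = (\<Sum>j\<in>opened ?h. usage ?h j / T j)"
    by (rule sum.mono_neutral_right) (auto simp: usage_not_opened)
  finally show ?case using Suc by simp
qed

lemma card_above_le:
  fixes T :: "nat \<Rightarrow> real"
  assumes "\<And>m. 0 \<le> x m" "\<And>j. 0 < T j"
  shows "real (card {j \<in> opened (run P x i). T j < usage (run P x i) j}) \<le> (\<Sum>m<i. x m / T (P (run P x m)))"
proof -
  let ?h = "run P x i"
  have "real (card {j \<in> opened ?h. T j < usage ?h j}) = (\<Sum>j\<in>{j \<in> opened ?h. T j < usage ?h j}. 1)"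
    by simp
  also have "\<dots> \<le> (\<Sum>j\<in>{j \<in> opened ?h. T j < usage ?h j}. usage ?h j / T j)"
    by (rule sum_mono) (use assms in \<open>auto simp: field_simps\<close>)
  also have "\<dots> \<le> (\<Sum>j\<in>opened ?h. usage ?h j / T j)"
    by (rule sum_mono2) (use assms usage_run_nonneg in \<open>auto intro!: divide_nonneg_pos\<close>)
  finally show ?thesis by (simp add: sum_usage_run)
qed

text \<open>
  The policy packs items of each rate separately.  It closes a bin for items of rate \<open>\<nu>\<close> once its usage
  exceeds \<open>1 - L / \<nu>\<close>; for \<open>L = ln C\<close>, an item of rate \<open>\<nu>\<close> that closes the bin overflows it
  with conditional probability \<open>exp (- \<nu> * (L / \<nu>)) = 1 / C\<close>.
\<close>

definition rate_bins :: "real \<Rightarrow> (nat \<Rightarrow> real) \<Rightarrow> history \<Rightarrow> nat set" where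
  "rate_bins L rate h = {j \<in> opened h. rate j = rate (length h) \<and> usage h j \<le> 1 - L / rate j}"

text \<open>
  A new bin is labelled by the index of the item that opens it, so that the label is fresh and
  \<open>rate j\<close> is the rate to which bin \<open>j\<close> is dedicated.
\<close>

definition rate_policy :: "real \<Rightarrow> (nat \<Rightarrow> real) \<Rightarrow> policy" where
  "rate_policy L rate h = (if rate_bins L rate h = {} then length h else Min (rate_bins L rate h))"

lemma finite_rate_bins: "finite (rate_bins L rate h)"
  by (simp add: rate_bins_def)

lemma rate_policy_cases:
  obtains "rate_bins L rate h = {}" "rate_policy L rate h = length h"
  | "rate_policy L rate h \<in> rate_bins L rate h"
  by (cases "rate_bins L rate h = {}") (auto simp: rate_policy_def finite_rate_bins)

lemma measurable_rate_policy: "measurable_policy (rate_policy L rate)"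
  unfolding measurable_policy_def
proof (intro allI)
  fix i b
  note [measurable] = measurable_usage_map[OF order_refl]
  have "(\<lambda>x. (\<lambda>A. if A = {} then i else Min A)
      {j \<in> b ` {..<i}. rate j = rate i \<and> usage (map (\<lambda>m. (b m, x m)) [0..<i]) j \<le> 1 - L / rate j})
    \<in> sizes i \<rightarrow>\<^sub>M count_space UNIV"
  proof (rule measurable_choice)
    fix j
    show "Measurable.pred (sizes i) (\<lambda>x. rate j = rate i \<and> usage (map (\<lambda>m. (b m, x m)) [0..<i]) j \<le> 1 - L / rate j)"
      by measurable
  qed simp
  then show "(\<lambda>x. rate_policy L rate (map (\<lambda>m. (b m, x m)) [0..<i])) \<in> sizes i \<rightarrow>\<^sub>M count_space UNIV"
    unfolding rate_policy_def rate_bins_def opened_map length_map length_upt diff_zero .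
qed

context
  fixes C :: real and rate :: "nat \<Rightarrow> real" and P :: policy
  assumes C: "1 \<le> C" and rate: "\<And>i. ln C < rate i"
  defines "P \<equiv> rate_policy (ln C) rate"
begin

lemma rate_pos: "0 < rate i"
  using rate[of i] ln_ge_zero[OF C] by linarith

lemma rate_threshold: "0 < 1 - ln C / rate i" "1 - ln C / rate i \<le> 1"
  using rate[of i] rate_pos[of i] ln_ge_zero[OF C] by (auto simp: field_simps)

lemma opened_rate_policy: "opened (run P x i) \<subseteq> {..<i}"
proof (induction i)
  case 0
  then show ?case by (simp add: opened_def)
next
  case (Suc i)
  then have "P (run P x i) \<in> {..<Suc i}" unfolding P_def
    by (cases rule: rate_policy_cases[of "ln C" rate "run (rate_policy (ln C) rate) x i"])
      (auto simp: rate_bins_def)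
  then show ?case using Suc by auto
qed

lemma rate_policy_choice:
  "rate (P (run P x i)) = rate i"
  "usage (run P x i) (P (run P x i)) \<le> 1 - ln C / rate i"
proof -
  have "i \<notin> opened (run P x i)" using opened_rate_policy[of x i] by auto
  then have "rate (P (run P x i)) = rate i \<and> usage (run P x i) (P (run P x i)) \<le> 1 - ln C / rate i"
    using rate_threshold(1)[of i] unfolding P_def
    by (cases rule: rate_policy_cases[of "ln C" rate "run (rate_policy (ln C) rate) x i"])
      (auto simp: rate_bins_def usage_not_opened)
  then show "rate (P (run P x i)) = rate i" "usage (run P x i) (P (run P x i)) \<le> 1 - ln C / rate i"
    by auto
qed

lemma rate_policy_in_policies: "P \<in> policies n"
proof -
  have "P (run P x i) \<notin> overflowed (run P x i)" for x i
    using order_trans[OF rate_policy_choice(2) rate_threshold(2)] by (simp add: overflowed_def not_less)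
  then show ?thesis by (simp add: policies_def P_def measurable_rate_policy)
qed

text \<open>
  Since a bin is opened only when no bin of the same rate is below its threshold, the unfinished bins
  have distinct rates.
\<close>

lemma inj_on_rate_below:
  assumes x: "\<And>m. 0 \<le> x m"
  shows "inj_on rate {j \<in> opened (run P x i). usage (run P x i) j \<le> 1 - ln C / rate j}"
proof (induction i)
  case 0
  then show ?case by (simp add: opened_def)
next
  case (Suc i)
  let ?h = "run P x i"
  let ?S = "\<lambda>h. {j \<in> opened h. usage h j \<le> 1 - ln C / rate j}"
  show ?case
  proof (cases rule: rate_policy_cases[of "ln C" rate ?h])
    case 1
    then have "?S (run P x (Suc i)) \<subseteq> insert i (?S ?h)"
      using x[of i] by (auto simp: usage_append P_def)
    moreover have "inj_on rate (insert i (?S ?h))"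
      unfolding inj_on_insert using Suc 1 by (auto simp: rate_bins_def)
    ultimately show ?thesis using inj_on_subset by blast
  next
    case 2
    then have "?S (run P x (Suc i)) \<subseteq> ?S ?h"
      using x[of i] by (auto simp: usage_append P_def rate_bins_def split: if_splits)
    then show ?thesis using Suc inj_on_subset by blast
  qed
qed

lemma card_opened_rate_policy_le:
  assumes x: "\<And>m. 0 \<le> x m"
  shows "card (opened (run P x i)) \<le> card (rate ` {..<i}) +
    card {j \<in> opened (run P x i). 1 - ln C / rate j < usage (run P x i) j}"
proof -
  let ?h = "run P x i"
  let ?S = "{j \<in> opened ?h. usage ?h j \<le> 1 - ln C / rate j}"
  let ?T = "{j \<in> opened ?h. 1 - ln C / rate j < usage ?h j}"
  have "card (opened ?h) = card (?S \<union> ?T)" by (rule arg_cong[where f = card]) auto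
  also have "\<dots> \<le> card ?S + card ?T" by (rule card_Un_le)
  also have "card ?S = card (rate ` ?S)" by (rule card_image[symmetric, OF inj_on_rate_below[OF x]])
  also have "\<dots> \<le> card (rate ` {..<i})"
    using opened_rate_policy[of x i] by (intro card_mono) auto
  finally show ?thesis by simp
qed

text \<open>
  The number of bins is at most the number of distinct rates plus the number of bins that pass their
  threshold (crossings).  By memorylessness an item overflows its bin with \<open>1 / C\<close> times the
  probability that it makes the bin cross, so the expected penalty equals the expected number of
  crossings.  The sizes in a crossing bin for rate \<open>\<nu>\<close> add up to more than the threshold
  \<open>1 - ln C / \<nu>\<close>, so the number of crossings is at most the sum of all \<open>x i / (1 - ln C / rate i)\<close>,
  and item \<open>i\<close> contributes \<open>1 / (rate i - ln C)\<close> to the expectation of this sum.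
\<close>

lemma cost_rate_policy_le:
  "cost C (exp_input rate n) P \<le> real (card (rate ` {..<n})) + 2 * (\<Sum>i<n. 1 / (rate i - ln C))"
proof -
  let ?M = "exp_sizes rate n"
  define s where "s i x = usage (run P x i) (P (run P x i))" for i x
  define th where "th i = 1 - ln C / rate i" for i
  define Cr where "Cr i = {x \<in> space ?M. s i x \<le> th i \<and> th i < s i x + x i}" for i
  define Ov where "Ov i = {x \<in> space ?M. s i x \<le> th i \<and> 1 < s i x + x i}" for i
  interpret prob_space ?M by (rule prob_space_exp_sizes) (rule rate_pos)
  have ad: "adapted n P" using measurable_policy_adapted measurable_rate_policy by (simp add: P_def)
  have s_meas: "s i \<in> borel_measurable (sizes n)" if i: "i < n" for i
    unfolding s_def
  proof (rule measurable_run[OF ad, where G = "\<lambda>h. usage h (P h)"])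
    fix b
    have "(\<lambda>x. P (map (\<lambda>m. (b m, x m)) [0..<i])) \<in> sizes n \<rightarrow>\<^sub>M count_space UNIV"
      using ad i by (simp add: adapted_def)
    then show "(\<lambda>x. usage (map (\<lambda>m. (b m, x m)) [0..<i]) (P (map (\<lambda>m. (b m, x m)) [0..<i]))) \<in> borel_measurable (sizes n)"
      by (rule measurable_compose_countable[rotated]) (use i in \<open>simp add: measurable_usage_map\<close>)
  qed (use i in simp)
  have s_upd: "s i (x(i := y)) = s i x" for i x y
    unfolding s_def using run_cong[of i "x(i := y)" x P] by simp
  have s_le: "s i x \<le> th i" for i x
    using rate_policy_choice(2) by (simp add: s_def th_def)
  have th: "0 < th i" "th i \<le> 1" for i using rate_threshold by (auto simp: th_def)
  have th_choice: "th (P (run P x i)) = th i" for x i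
    using rate_policy_choice(1)[of x i] by (simp add: th_def)
  have comp: "(\<lambda>x. x i) \<in> borel_measurable ?M" if "i < n" for i
    unfolding measurable_exp_sizes using that by (intro measurable_component_singleton) auto
  have sets: "Cr i \<in> sets ?M" "Ov i \<in> sets ?M" if "i < n" for i
  proof -
    note [measurable] = comp[OF that] s_meas[OF that, folded measurable_exp_sizes[where rate = rate]]
    show "Cr i \<in> sets ?M" "Ov i \<in> sets ?M" unfolding Cr_def Ov_def by measurable
  qed
  \<comment> \<open>Expected penalty and expected number of crossings are exchanged item by item.\<close>
  have exch: "C * prob (Ov i) = prob (Cr i)" if i: "i < n" for i
  proof -
    have "prob (Ov i) = exp (- rate i * (1 - th i)) * prob (Cr i)"
      unfolding Ov_def Cr_def using memoryless_crossing[OF rate_pos i s_meas[OF i] s_upd th(2)] .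
    also have "exp (- rate i * (1 - th i)) = 1 / C"
      using C rate_pos[of i] by (simp add: th_def exp_minus inverse_eq_divide)
    finally show ?thesis using C by simp
  qed
  have overflowed_eq: "real (card (overflowed (run P x n))) = (\<Sum>i<n. indicator (Ov i) x)"
    if "x \<in> space ?M" for x
  proof -
    have "real (card (overflowed (run P x n))) = (\<Sum>m<n. of_bool (1 < s m x + x m))"
      unfolding overflowed_def s_def
      by (rule real_card_above_run[where T = "\<lambda>_. 1"]) (rule order_trans[OF s_le[unfolded s_def] th(2)])
    also have "\<dots> = (\<Sum>i<n. indicator (Ov i) x)"
      using that s_le by (intro sum.cong) (auto simp: Ov_def indicator_def)
    finally show ?thesis .
  qed
  have above_eq: "real (card {j \<in> opened (run P x n). th j < usage (run P x n) j}) = (\<Sum>i<n. indicator (Cr i) x)"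
    if "x \<in> space ?M" for x
  proof -
    have "real (card {j \<in> opened (run P x n). th j < usage (run P x n) j}) =
        (\<Sum>m<n. of_bool (th (P (run P x m)) < s m x + x m))"
      unfolding s_def by (rule real_card_above_run) (use s_le th_choice in \<open>simp add: s_def\<close>)
    also have "\<dots> = (\<Sum>i<n. indicator (Cr i) x)"
      using that s_le by (intro sum.cong) (auto simp: Cr_def indicator_def th_choice)
    finally show ?thesis .
  qed
  have AE: "AE x in ?M. x \<in> space ?M \<and> (\<forall>i<n. 0 \<le> x i)"
    using AE_space[of ?M] AE_exp_sizes_nonneg[OF rate_pos, of n] by eventually_elim simp
  have pointwise: "real (card (opened (run P x n))) \<le> real (card (rate ` {..<n})) + (\<Sum>i<n. indicator (Cr i) x) \<and>
      (\<Sum>i<n. indicator (Cr i) x) \<le> (\<Sum>i<n. x i / th i)"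
    if x: "x \<in> space ?M" "\<forall>i<n. 0 \<le> x i" for x
  proof -
    \<comment> \<open>Sizes are almost surely nonnegative only on the coordinates of the input; the others do not affect the run.\<close>
    define y where "y m = (if m < n then x m else 0)" for m
    have y: "0 \<le> y m" for m using x by (simp add: y_def)
    have run: "run P x n = run P y n" by (rule run_cong) (simp add: y_def)
    have "real (card (opened (run P x n))) \<le> real (card (rate ` {..<n})) +
        real (card {j \<in> opened (run P x n). th j < usage (run P x n) j})"
      unfolding run th_def using card_opened_rate_policy_le[where x = y and i = n] y by (simp flip: of_nat_add)
    moreover have "real (card {j \<in> opened (run P x n). th j < usage (run P x n) j}) \<le> (\<Sum>m<n. y m / th m)"
      unfolding run using card_above_le[of y th P n] y th by (simp add: th_choice)
    moreover have "(\<Sum>m<n. y m / th m) = (\<Sum>m<n. x m / th m)" by (simp add: y_def)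
    ultimately show ?thesis using above_eq[OF x(1)] by simp
  qed
  have AE_pw: "AE x in ?M. real (card (opened (run P x n))) \<le> real (card (rate ` {..<n})) + (\<Sum>i<n. indicator (Cr i) x)"
      "AE x in ?M. (\<Sum>i<n. indicator (Cr i) x) \<le> (\<Sum>i<n. x i / th i)"
    by (rule eventually_mono[OF AE]; use pointwise in blast)+
  have intCr: "integrable ?M (\<lambda>x. \<Sum>i<n. indicator (Cr i) x :: real)"
    using sets by (intro Bochner_Integration.integrable_sum integrable_real_indicator) (auto simp: emeasure_eq_measure)
  have EA: "(\<integral>x. (\<Sum>i<n. indicator (Cr i) x) \<partial>?M) = (\<Sum>i<n. prob (Cr i))"
    using sets by (subst Bochner_Integration.integral_sum) (auto simp: emeasure_eq_measure)
  have "(\<integral>x. real (card (overflowed (run P x n))) \<partial>?M) = (\<integral>x. (\<Sum>i<n. indicator (Ov i) x) \<partial>?M)"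
    by (rule Bochner_Integration.integral_cong) (use overflowed_eq in auto)
  also have "\<dots> = (\<Sum>i<n. prob (Ov i))"
    using sets by (subst Bochner_Integration.integral_sum) (auto simp: emeasure_eq_measure)
  finally have EO: "C * (\<integral>x. real (card (overflowed (run P x n))) \<partial>?M) = (\<Sum>i<n. prob (Cr i))"
    by (simp add: sum_distrib_left exch)
  have "(\<integral>x. real (card (opened (run P x n))) \<partial>?M) \<le>
      (\<integral>x. real (card (rate ` {..<n})) + (\<Sum>i<n. indicator (Cr i) x) \<partial>?M)"
    by (rule integral_mono_AE) (use AE_pw in \<open>auto intro!: integrable_card_opened rate_pos ad intCr\<close>)
  also have "\<dots> = real (card (rate ` {..<n})) + (\<Sum>i<n. prob (Cr i))"
    using intCr by (subst Bochner_Integration.integral_add) (auto simp: EA prob_space)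
  finally have EN: "(\<integral>x. real (card (opened (run P x n))) \<partial>?M) \<le> real (card (rate ` {..<n})) + (\<Sum>i<n. prob (Cr i))" .
  have "(\<Sum>i<n. prob (Cr i)) \<le> (\<integral>x. (\<Sum>i<n. x i / th i) \<partial>?M)"
    unfolding EA[symmetric]
    by (rule integral_mono_AE) (use AE_pw in \<open>auto intro!: intCr integral_exp_sizes_component(1) rate_pos\<close>)
  also have "\<dots> = (\<Sum>i<n. 1 / rate i / th i)"
    by (subst Bochner_Integration.integral_sum)
      (auto intro!: integral_exp_sizes_component(1) rate_pos simp: integral_exp_sizes_component(2)[OF rate_pos])
  also have "\<dots> = (\<Sum>i<n. 1 / (rate i - ln C))"
  proof (intro sum.cong refl)
    fix i
    have "rate i * th i = rate i - ln C" using rate_pos[of i] by (simp add: th_def right_diff_distrib)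
    then show "1 / rate i / th i = 1 / (rate i - ln C)" by (simp add: divide_divide_eq_left)
  qed
  finally show ?thesis
    using EN EO unfolding cost_def length_exp_input item_space_exp_input by simp
qed

end

lemma opt_cost_exp_input_bounds:
  assumes C: "1 \<le> C" and rate: "\<And>i. ln C < rate i" and n: "0 < n"
  shows "1 \<le> opt_cost C (exp_input rate n)"
    and "opt_cost C (exp_input rate n) \<le> real (card (rate ` {..<n})) + 2 * (\<Sum>i<n. 1 / (rate i - ln C))"
proof -
  have pos: "0 < rate i" for i by (rule rate_pos[OF C rate])
  have ge: "1 \<le> cost C (exp_input rate n) P" if "P \<in> policies n" for P
    using that C by (intro one_le_cost pos n) (auto simp: policies_def)
  have P: "rate_policy (ln C) rate \<in> policies n" by (rule rate_policy_in_policies[OF C rate])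
  show "1 \<le> opt_cost C (exp_input rate n)"
    unfolding opt_cost_def length_exp_input using P ge by (intro cINF_greatest) auto
  have "opt_cost C (exp_input rate n) \<le> cost C (exp_input rate n) (rate_policy (ln C) rate)"
    unfolding opt_cost_def length_exp_input using P ge by (intro cINF_lower bdd_belowI2) auto
  also have "\<dots> \<le> real (card (rate ` {..<n})) + 2 * (\<Sum>i<n. 1 / (rate i - ln C))"
    by (rule cost_rate_policy_le[OF C rate])
  finally show "opt_cost C (exp_input rate n) \<le> real (card (rate ` {..<n})) + 2 * (\<Sum>i<n. 1 / (rate i - ln C))" .
qed

section \<open>Budgeted Greedy opens a bin for almost every slow item\<close>

text \<open>
  Budgeted Greedy opens bins with labels 0, 1, 2, and so on, so the newest one has the largest label.
  Preferring the newest bin sends the fast items after the slow one that precedes them, and they fill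
  its bin beyond the level at which another slow item is admitted.
\<close>

definition newest_bin :: "history \<Rightarrow> nat set \<Rightarrow> nat" where
  "newest_bin h A = Max A"

lemma tie_breaking_newest_bin: "tie_breaking newest_bin"
  by (auto simp: tie_breaking_def newest_bin_def measurable_policy_def)

lemma risk_append:
  "risk D (h @ [(b, y)]) j =
    risk D h j + (if j = b then overflow_prob (D ! length h) (usage h j) else 0)"
proof -
  define h' where "h' = h @ [(b, y)]"
  define S where "S = {i. i < length h \<and> fst (h ! i) = j}"
  have S: "finite S" "length h \<notin> S" by (auto simp: S_def)
  have S': "{i. i < length h' \<and> fst (h' ! i) = j} = (if j = b then insert (length h) S else S)"
    by (auto simp: nth_append less_Suc_eq S_def h'_def)
  have take: "take i h' = take i h" if "i \<le> length h" for i
    using that by (simp add: h'_def)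
  have "(\<Sum>i\<in>S. overflow_prob (D ! i) (usage (take i h') j)) = risk D h j"
    unfolding risk_def S_def[symmetric] by (rule sum.cong) (auto simp: take S_def)
  moreover have "risk D h' j = (\<Sum>i\<in>S. overflow_prob (D ! i) (usage (take i h') j)) +
      (if j = b then overflow_prob (D ! length h) (usage h j) else 0)"
    unfolding risk_def S' using S take[of "length h"] by simp
  ultimately show ?thesis by (simp add: h'_def)
qed

lemma risk_nonneg: "0 \<le> risk D h j"
  unfolding risk_def by (intro sum_nonneg overflow_prob_nonneg)

lemma adapted_budgeted_greedy:
  assumes pos: "\<And>i. 0 < rate i"
  shows "adapted n (budgeted_greedy newest_bin \<gamma> C (exp_input rate n))"
  unfolding adapted_def
proof (intro allI impI)
  fix i and b :: "nat \<Rightarrow> nat" assume i: "i < n"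
  let ?D = "exp_input rate n"
  let ?h = "\<lambda>(x :: nat \<Rightarrow> real) i. map (\<lambda>m. (b m, x m)) [0..<i]"
  note [measurable] = borel_measurable_overflow_prob_expm[OF pos]
  have use [measurable]: "(\<lambda>x. usage (?h x m) j) \<in> borel_measurable (sizes n)" if "m \<le> i" for m j
    using measurable_usage_map[of m n b j] i that by simp
  have risk: "risk ?D (?h x i) j = (\<Sum>m\<in>{m. m < i \<and> b m = j}. overflow_prob (expm (rate m)) (usage (?h x m) j))" for x j
    unfolding risk_def
    by (rule sum.cong) (use i in \<open>auto simp: take_map\<close>)
  have op: "(\<lambda>x. overflow_prob (expm (rate m)) (usage (?h x m) j)) \<in> borel_measurable (sizes n)" if "m \<le> i" for m j
    by (rule measurable_compose[OF use[OF that] borel_measurable_overflow_prob_expm[OF pos]])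
  have [measurable]: "(\<lambda>x. risk ?D (?h x i) j) \<in> borel_measurable (sizes n)" for j
    unfolding risk by (intro borel_measurable_sum op) auto
  note [measurable] = op[OF order_refl]
  have adm: "admissible \<gamma> C ?D (?h x i) = {j \<in> b ` {..<i}. \<not> 1 < usage (?h x i) j \<and>
      risk ?D (?h x i) j + overflow_prob (expm (rate i)) (usage (?h x i) j) \<le> \<gamma> / C}" for x
    unfolding admissible_def overflowed_def opened_map using i by auto
  have "(\<lambda>x. (\<lambda>A. if A = {} then LEAST j. j \<notin> b ` {..<i} else Max A) {j \<in> b ` {..<i}. \<not> 1 < usage (?h x i) j \<and>
      risk ?D (?h x i) j + overflow_prob (expm (rate i)) (usage (?h x i) j) \<le> \<gamma> / C}) \<in> sizes n \<rightarrow>\<^sub>M count_space UNIV"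
  proof (rule measurable_choice)
    fix j
    note [measurable] = use[OF order_refl]
    show "Measurable.pred (sizes n) (\<lambda>x. \<not> 1 < usage (?h x i) j \<and>
      risk ?D (?h x i) j + overflow_prob (expm (rate i)) (usage (?h x i) j) \<le> \<gamma> / C)"
      by measurable
  qed simp
  then show "(\<lambda>x. budgeted_greedy newest_bin \<gamma> C ?D (?h x i)) \<in> sizes n \<rightarrow>\<^sub>M count_space UNIV"
    unfolding budgeted_greedy_def newest_bin_def adm opened_map .
qed

text \<open>
  A dead bin accepts no item of the slowest rate \<open>lam\<close>, now or later, because neither its usage nor
  its risk ever decreases.
\<close>

definition dead :: "real \<Rightarrow> real \<Rightarrow> input \<Rightarrow> real \<Rightarrow> history \<Rightarrow> nat \<Rightarrow> bool" where
  "dead \<gamma> C D lam h j \<longleftrightarrow>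
     j \<in> overflowed h \<or> \<gamma> / C < risk D h j + overflow_prob (expm lam) (usage h j)"

context
  fixes \<gamma> C lam :: real and rate :: "nat \<Rightarrow> real" and n :: nat and x :: "nat \<Rightarrow> real"
    and D :: input and G :: policy and H :: "nat \<Rightarrow> history" and N :: "nat \<Rightarrow> nat"
  assumes lam: "0 < lam" and rate: "\<And>i. lam \<le> rate i" and x: "\<And>i. 0 \<le> x i"
  defines "D \<equiv> exp_input rate n"
    and "G \<equiv> budgeted_greedy newest_bin \<gamma> C D"
    and "H \<equiv> run G x"
    and "N \<equiv> \<lambda>i. card (opened (H i))"
begin

lemma greedy_history_Suc: "H (Suc i) = H i @ [(G (H i), x i)]"
  by (simp add: H_def)

lemma length_greedy_history [simp]: "length (H i) = i"
  by (simp add: H_def)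

lemma dead_Suc:
  assumes "dead \<gamma> C D lam (H i) j"
  shows "dead \<gamma> C D lam (H (Suc i)) j"
proof -
  have "usage (H i) j \<le> usage (H (Suc i)) j" using x[of i] by (simp add: greedy_history_Suc usage_append)
  moreover have "risk D (H i) j \<le> risk D (H (Suc i)) j"
    by (simp add: greedy_history_Suc risk_append overflow_prob_nonneg)
  moreover have "opened (H i) \<subseteq> opened (H (Suc i))" by (auto simp: greedy_history_Suc)
  ultimately show ?thesis
    using assms overflow_prob_expm_mono[OF lam order_refl, of "usage (H i) j" "usage (H (Suc i)) j"]
    by (fastforce simp: dead_def overflowed_def)
qed

lemma dead_mono:
  assumes "i \<le> m" "dead \<gamma> C D lam (H i) j"
  shows "dead \<gamma> C D lam (H m) j"
  using assms by (induction m rule: dec_induct) (auto intro: dead_Suc)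

text \<open>
  A bin that rejects any item is dead, since items of rate \<open>lam\<close> are the riskiest ones.
\<close>

lemma dead_if_not_admissible:
  assumes "i < n" "j \<in> opened (H i)" "j \<notin> admissible \<gamma> C D (H i)"
  shows "dead \<gamma> C D lam (H i) j"
  using assms overflow_prob_expm_mono[OF lam rate order_refl, of i "usage (H i) j"]
  by (auto simp: dead_def admissible_def D_def)

lemma not_dead_if_admissible:
  assumes "i < n" "rate i = lam" "j \<in> admissible \<gamma> C D (H i)"
  shows "\<not> dead \<gamma> C D lam (H i) j"
  using assms by (auto simp: dead_def admissible_def D_def)

lemma finite_admissible: "finite (admissible \<gamma> C D h)"
  by (simp add: admissible_def)

lemma greedy_cases:
  obtains "admissible \<gamma> C D (H i) = {}" "G (H i) = (LEAST j. j \<notin> opened (H i))"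
  | "G (H i) \<in> admissible \<gamma> C D (H i)" "G (H i) = Max (admissible \<gamma> C D (H i))"
  using finite_admissible by (cases "admissible \<gamma> C D (H i) = {}")
    (auto simp: G_def budgeted_greedy_def newest_bin_def)

lemma opened_greedy: "opened (H i) = {..<N i}"
proof (induction i)
  case 0
  then show ?case by (simp add: H_def N_def opened_def)
next
  case (Suc i)
  show ?case
  proof (cases rule: greedy_cases[of i])
    case 1
    have "(LEAST j. j \<notin> opened (H i)) = N i"
      unfolding Suc by (rule Least_equality) auto
    then have "opened (H (Suc i)) = {..<Suc (N i)}"
      using 1 Suc by (auto simp: greedy_history_Suc)
    moreover from this have "N (Suc i) = Suc (N i)" unfolding N_def[THEN meta_eq_to_obj_eq, THEN fun_cong, of "Suc i"] by simp
    ultimately show ?thesis by simp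
  next
    case 2
    then have "opened (H (Suc i)) = opened (H i)"
      by (auto simp: greedy_history_Suc admissible_def)
    moreover from this have "N (Suc i) = N i" by (simp add: N_def)
    ultimately show ?thesis using Suc by simp
  qed
qed

lemma greedy_new_or_admissible:
  obtains "admissible \<gamma> C D (H i) = {}" "G (H i) = N i" "N (Suc i) = Suc (N i)"
  | "G (H i) \<in> admissible \<gamma> C D (H i)" "G (H i) = Max (admissible \<gamma> C D (H i))" "G (H i) < N i" "N (Suc i) = N i"
proof (cases rule: greedy_cases[of i])
  case 1
  have "(LEAST j. j \<notin> opened (H i)) = N i"
    unfolding opened_greedy by (rule Least_equality) auto
  with 1 have new: "G (H i) = N i" by simp
  have "opened (H (Suc i)) = {..<Suc (N i)}"
    unfolding greedy_history_Suc opened_append new opened_greedy lessThan_Suc ..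
  then have "N (Suc i) = Suc (N i)" unfolding N_def[THEN meta_eq_to_obj_eq, THEN fun_cong, of "Suc i"] by simp
  then show ?thesis using 1(1) new by (intro that(1))
next
  case 2
  then have "G (H i) \<in> opened (H i)" by (auto simp: admissible_def)
  then have less: "G (H i) < N i" and "opened (H (Suc i)) = opened (H i)"
    using opened_greedy[of i] by (auto simp: greedy_history_Suc)
  then have "N (Suc i) = N i" by (simp add: N_def)
  then show ?thesis using 2 less by (intro that(2))
qed

lemma opened_count_mono: "i \<le> m \<Longrightarrow> N i \<le> N m"
proof (induction m rule: dec_induct)
  case (step m)
  then show ?case by (cases rule: greedy_new_or_admissible[of m]) auto
qed simp

text \<open>
  A bin is opened only when all existing ones reject the current item, and are therefore dead.
\<close>

lemma older_bins_dead:
  assumes "i \<le> n" "Suc j < N i"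
  shows "dead \<gamma> C D lam (H i) j"
  using assms
proof (induction i)
  case 0
  then show ?case by (simp add: N_def H_def opened_def)
next
  case (Suc i)
  show ?case
  proof (cases rule: greedy_new_or_admissible[of i])
    case 1
    then have "j \<in> opened (H i)" using Suc.prems opened_greedy[of i] by simp
    with 1 Suc.prems show ?thesis by (intro dead_Suc dead_if_not_admissible) auto
  next
    case 2
    with Suc show ?thesis by (auto intro: dead_Suc)
  qed
qed

lemma slow_item_in_newest:
  assumes "i < n" "rate i = lam"
  shows "Suc (G (H i)) = N (Suc i)"
proof (cases rule: greedy_new_or_admissible[of i])
  case 2
  then have "\<not> dead \<gamma> C D lam (H i) (G (H i))" using not_dead_if_admissible assms by blast
  then have "\<not> Suc (G (H i)) < N i" using older_bins_dead assms(1) by (meson less_imp_le)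
  then show ?thesis using 2 by simp
qed simp

lemma item_in_newest:
  assumes i: "i < n" and j: "Suc j = N i" and alive: "\<not> dead \<gamma> C D lam (H i) j"
  shows "G (H i) = j"
proof -
  have op: "l \<in> opened (H i) \<longleftrightarrow> l \<le> j" for l
    unfolding opened_greedy j[symmetric] lessThan_iff less_Suc_eq_le ..
  then have adm: "j \<in> admissible \<gamma> C D (H i)"
    using dead_if_not_admissible[OF i _] alive by blast
  have "l \<le> j" if "l \<in> admissible \<gamma> C D (H i)" for l
    using that op by (simp add: admissible_def)
  with adm have "Max (admissible \<gamma> C D (H i)) = j"
    by (intro Max_eqI finite_admissible)
  with adm show ?thesis by (cases rule: greedy_new_or_admissible[of i]) auto
qed

text \<open>
  If no bin is opened between two slow items, the second one goes to the newest bin, because the others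
  are dead.  That bin has been alive all the time and so has received everything from the first slow
  item on, which is why the total size of these items must be admissible for a slow item.
\<close>

lemma block_fits_if_no_bin_opened:
  assumes a: "0 < a" "a \<le> c" and c: "c < n" and slow: "rate (a - 1) = lam" "rate c = lam"
    and same: "N (Suc c) = N a"
  shows "overflow_prob (expm lam) (\<Sum>m\<in>{a - 1..<c}. x m) \<le> \<gamma> / C"
proof -
  define j where "j = G (H c)"
  have Nc: "N m = N a" if "a \<le> m" "m \<le> Suc c" for m
    using opened_count_mono[OF that(1)] opened_count_mono[OF that(2)] same by simp
  have j: "Suc j = N a" using slow_item_in_newest[OF c slow(2)] same by (simp add: j_def)
  have "j \<in> admissible \<gamma> C D (H c)"
    using Nc[of c] same a unfolding j_def by (cases rule: greedy_new_or_admissible[of c]) auto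
  then have alive: "\<not> dead \<gamma> C D lam (H c) j" using not_dead_if_admissible[OF c slow(2)] by blast
  have Ga: "G (H (a - 1)) = j"
  proof -
    have "a - 1 < n" "Suc (a - 1) = a" using a c by auto
    with slow_item_in_newest[OF _ slow(1)] j show ?thesis by simp
  qed
  have "(\<Sum>l\<in>{a - 1..<m}. x l) \<le> usage (H m) j" if "a \<le> m" "m \<le> c" for m
    using that
  proof (induction m rule: dec_induct)
    case base
    have "H a = H (a - 1) @ [(j, x (a - 1))]" using greedy_history_Suc[of "a - 1"] a Ga by simp
    moreover have "0 \<le> usage (H (a - 1)) j" unfolding H_def by (rule usage_run_nonneg[OF x])
    moreover have "{a - 1..<a} = {a - 1}" using a by auto
    ultimately show ?case by (simp add: usage_append)
  next
    case (step m)
    have "\<not> dead \<gamma> C D lam (H m) j" using alive dead_mono[of m c] step.prems by auto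
    then have "G (H m) = j" using step c Nc[of m] j by (intro item_in_newest) auto
    then have "usage (H (Suc m)) j = usage (H m) j + x m" by (simp add: greedy_history_Suc usage_append)
    moreover have "(\<Sum>l\<in>{a - 1..<Suc m}. x l) = (\<Sum>l\<in>{a - 1..<m}. x l) + x m"
      using step by (intro sum.atLeastLessThan_Suc) auto
    ultimately show ?case using step by simp
  qed
  then have "overflow_prob (expm lam) (\<Sum>m\<in>{a - 1..<c}. x m) \<le> overflow_prob (expm lam) (usage (H c) j)"
    using a by (intro overflow_prob_expm_mono lam) auto
  also have "\<dots> \<le> \<gamma> / C"
    using alive risk_nonneg[of D "H c" j] by (auto simp: dead_def)
  finally show ?thesis .
qed

text \<open>
  The first block always opens a bin; the block with number \<open>i \<ge> 1\<close> opens one if the slow item before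
  it (index \<open>i * (k + 1) - 1\<close>) and its \<open>k\<close> fast items leave no room for its own slow item.
\<close>

lemma opened_count_ge_blocks:
  assumes n: "n = n1 * (k + 1)" and slow: "\<And>m. m mod (k + 1) = k \<Longrightarrow> rate m = lam" and b: "1 \<le> b" "b \<le> n1"
  shows "1 + (\<Sum>i\<in>{1..<b}. of_bool (\<gamma> / C < overflow_prob (expm lam) (\<Sum>m\<in>{i * (k + 1) - 1..<i * (k + 1) + k}. x m)))
    \<le> N (b * (k + 1))"
proof -
  define e where "e i \<longleftrightarrow> \<gamma> / C < overflow_prob (expm lam) (\<Sum>m\<in>{i * (k + 1) - 1..<i * (k + 1) + k}. x m)" for i
  have "1 + (\<Sum>i\<in>{1..<b}. of_bool (e i)) \<le> N (b * (k + 1))"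
    using b
  proof (induction b rule: dec_induct)
    case base
    have "N (Suc 0) \<ge> 1" by (simp add: N_def greedy_history_Suc Suc_le_eq card_gt_0_iff)
    with opened_count_mono[of "Suc 0" "1 * (k + 1)"] show ?case by simp
  next
    case (step b)
    define a where "a = b * (k + 1)"
    have a: "0 < a" using step by (simp add: a_def)
    have Suc_b: "Suc (a + k) = Suc b * (k + 1)" by (simp add: a_def)
    have "Suc b * (k + 1) \<le> n1 * (k + 1)" using step by (intro mult_le_mono1) auto
    then have c: "a + k < n" unfolding Suc_b[symmetric] n by simp
    have "(a + k) mod (k + 1) = k" unfolding a_def by (subst mod_mult_self3) simp
    then have s2: "rate (a + k) = lam" by (rule slow)
    have "a - 1 = (b - 1) * (k + 1) + k" using step by (cases b) (auto simp: a_def)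
    then have "(a - 1) mod (k + 1) = k" by (simp only: mod_mult_self3) simp
    then have s1: "rate (a - 1) = lam" by (rule slow)
    have "N a + of_bool (e b) \<le> N (Suc (a + k))"
      using block_fits_if_no_bin_opened[OF a _ c s1 s2] opened_count_mono[of a "Suc (a + k)"]
      by (cases "N (Suc (a + k)) = N a") (auto simp: e_def a_def not_less)
    moreover have "(\<Sum>i\<in>{1..<Suc b}. of_bool (e i)) = (\<Sum>i\<in>{1..<b}. of_bool (e i)) + (of_bool (e b) :: nat)"
      using step by simp
    moreover have "1 + (\<Sum>i\<in>{1..<b}. of_bool (e i)) \<le> N a" using step by (simp add: a_def)
    ultimately show ?case unfolding Suc_b by linarith
  qed
  then show ?thesis by (simp add: e_def)
qed

end

section \<open>The cost of Budgeted Greedy\<close>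

lemma cost_greedy_blocks_ge:
  fixes rate :: "nat \<Rightarrow> real"
  assumes lam: "0 < lam" and rate: "\<And>i. lam \<le> rate i"
    and slow: "\<And>m. m mod (k + 1) = k \<Longrightarrow> rate m = lam"
    and C: "0 \<le> C" and n1: "1 \<le> n1"
    and q: "\<And>s. s > \<theta> \<Longrightarrow> \<gamma> / C < overflow_prob (expm lam) s"
    and half: "\<And>b. 1 \<le> b \<Longrightarrow> b < n1 \<Longrightarrow>
      1 / 2 \<le> measure (exp_sizes rate (n1 * (k + 1)))
        {x \<in> space (exp_sizes rate (n1 * (k + 1))). \<theta> < (\<Sum>m\<in>{b * (k + 1) - 1..<b * (k + 1) + k}. x m)}"
  shows "1 / 2 * real n1 \<le> cost C (exp_input rate (n1 * (k + 1)))
    (budgeted_greedy newest_bin \<gamma> C (exp_input rate (n1 * (k + 1))))"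
proof -
  define n where "n = n1 * (k + 1)"
  define G where "G = budgeted_greedy newest_bin \<gamma> C (exp_input rate n)"
  let ?M = "exp_sizes rate n"
  define S where "S b x = (\<Sum>m\<in>{b * (k + 1) - 1..<b * (k + 1) + k}. x m)" for b and x :: "nat \<Rightarrow> real"
  define E where "E b = {x \<in> space ?M. \<theta> < S b x}" for b
  have pos: "0 < rate i" for i using lam rate[of i] by linarith
  interpret prob_space ?M by (rule prob_space_exp_sizes) (rule pos)
  have sub: "{b * (k + 1) - 1..<b * (k + 1) + k} \<subseteq> {..<n}" if "b < n1" for b
  proof -
    have "Suc b * (k + 1) \<le> n" unfolding n_def using that by (intro mult_le_mono1) auto
    then show ?thesis by auto
  qed
  have sets: "E b \<in> sets ?M" if "b < n1" for b
  proof -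
    have "(\<lambda>x. x m) \<in> borel_measurable ?M" if "m \<in> {b * (k + 1) - 1..<b * (k + 1) + k}" for m
      unfolding measurable_exp_sizes using sub[OF \<open>b < n1\<close>] that by (intro measurable_component_singleton) auto
    then have [measurable]: "S b \<in> borel_measurable ?M"
      unfolding S_def by (intro borel_measurable_sum)
    show ?thesis unfolding E_def by measurable
  qed
  have pointwise: "1 + (\<Sum>b\<in>{1..<n1}. indicator (E b) x) \<le> real (card (opened (run G x n)))"
    if x: "x \<in> space ?M" "\<forall>i<n. 0 \<le> x i" for x
  proof -
    \<comment> \<open>Sizes are almost surely nonnegative only on the coordinates of the input; the others do not affect the run.\<close>
    define y where "y m = (if m < n then x m else 0)" for m
    have y: "0 \<le> y m" for m using x by (simp add: y_def)
    have run: "run G x n = run G y n" by (rule run_cong) (simp add: y_def)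
    have "1 + (\<Sum>b\<in>{1..<n1}. of_bool (\<gamma> / C < overflow_prob (expm lam) (S b y))) \<le> card (opened (run G y n))"
      unfolding G_def S_def
      using opened_count_ge_blocks[OF lam rate y n_def slow n1 order_refl, where \<gamma> = \<gamma> and C = C] unfolding n_def[symmetric] .
    then have "1 + (\<Sum>b\<in>{1..<n1}. of_bool (\<gamma> / C < overflow_prob (expm lam) (S b y))) \<le> real (card (opened (run G y n)))"
      by (rule of_nat_mono[where 'a = real, THEN order_trans[rotated]])
        (simp only: of_nat_add of_nat_1 of_nat_sum of_nat_of_bool order_refl)
    moreover have "(\<Sum>b\<in>{1..<n1}. indicator (E b) x) \<le>
        (\<Sum>b\<in>{1..<n1}. of_bool (\<gamma> / C < overflow_prob (expm lam) (S b y)) :: real)"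
    proof (rule sum_mono)
      fix b assume b: "b \<in> {1..<n1}"
      have "S b y = S b x"
        unfolding S_def y_def using sub[of b] b by (intro sum.cong) auto
      then show "indicator (E b) x \<le> (of_bool (\<gamma> / C < overflow_prob (expm lam) (S b y)) :: real)"
        using q[of "S b y"] by (auto simp: E_def indicator_def)
    qed
    ultimately show ?thesis unfolding run by linarith
  qed
  have AE: "AE x in ?M. 1 + (\<Sum>b\<in>{1..<n1}. indicator (E b) x) \<le> real (card (opened (run G x n)))"
  proof -
    have "AE x in ?M. x \<in> space ?M \<and> (\<forall>i<n. 0 \<le> x i)"
      using AE_space[of ?M] AE_exp_sizes_nonneg[OF pos, of n] by eventually_elim simp
    then show ?thesis by (rule eventually_mono) (use pointwise in blast)
  qed
  have int: "integrable ?M (\<lambda>x. \<Sum>b\<in>{1..<n1}. indicator (E b) x :: real)"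
    using sets by (intro Bochner_Integration.integrable_sum integrable_real_indicator) (auto simp: emeasure_eq_measure)
  have "1 / 2 * real n1 \<le> 1 + (real n1 - 1) / 2" by (simp add: field_simps)
  also have "\<dots> = 1 + (\<Sum>b\<in>{1..<n1}. 1 / 2)" using n1 by (simp add: of_nat_diff)
  also have "\<dots> \<le> 1 + (\<Sum>b\<in>{1..<n1}. prob (E b))"
    using half by (intro add_left_mono sum_mono) (auto simp: E_def S_def n_def)
  also have "\<dots> = (\<integral>x. 1 + (\<Sum>b\<in>{1..<n1}. indicator (E b) x) \<partial>?M)"
  proof -
    have "(\<integral>x. (\<Sum>b\<in>{1..<n1}. indicator (E b) x) \<partial>?M) = (\<Sum>b\<in>{1..<n1}. prob (E b))"
      using sets by (subst Bochner_Integration.integral_sum) (auto simp: emeasure_eq_measure)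
    then show ?thesis using int by (subst Bochner_Integration.integral_add) (auto simp: prob_space)
  qed
  also have "\<dots> \<le> (\<integral>x. real (card (opened (run G x n))) \<partial>?M)"
    by (rule integral_mono_AE)
      (use AE int in \<open>auto intro!: integrable_card_opened pos simp: G_def adapted_budgeted_greedy[OF pos]\<close>)
  also have "\<dots> \<le> cost C (exp_input rate n) G" by (rule cost_exp_input_ge[OF C])
  finally show ?thesis unfolding G_def n_def .
qed

section \<open>The hard input\<close>

definition hard_rate :: "real \<Rightarrow> real \<Rightarrow> nat \<Rightarrow> nat \<Rightarrow> nat \<Rightarrow> real" where
  "hard_rate C \<epsilon> n1 k m = (if m mod (k + 1) = k then hard_lambda C \<epsilon> else hard_mu C \<epsilon> n1)"

lemma concat_replicate_block:
  "concat (replicate r (replicate k u @ [v])) =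
    map (\<lambda>m. if m mod (k + 1) = k then v else u) [0..<r * (k + 1)]"
proof (induction r)
  case (Suc r)
  let ?f = "\<lambda>m. if m mod (k + 1) = k then v else u"
  have "map ?f [r * (k + 1)..<r * (k + 1) + (k + 1)] = replicate k u @ [v]"
  proof (rule nth_equalityI)
    fix i assume "i < length (map ?f [r * (k + 1)..<r * (k + 1) + (k + 1)])"
    then have i: "i < k + 1" by simp
    moreover have "(r * (k + 1) + i) mod (k + 1) = i"
      using i by (subst mod_mult_self3) simp
    ultimately show "map ?f [r * (k + 1)..<r * (k + 1) + (k + 1)] ! i = (replicate k u @ [v]) ! i"
      by (auto simp: nth_append simp del: mult_Suc_right add_Suc_right)
  qed simp
  moreover have "concat (replicate (Suc r) (replicate k u @ [v])) =
      concat (replicate r (replicate k u @ [v])) @ replicate k u @ [v]"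
    by (simp flip: replicate_append_same)
  moreover have "[0..<Suc r * (k + 1)] = [0..<r * (k + 1)] @ [r * (k + 1)..<r * (k + 1) + (k + 1)]"
  proof -
    have "Suc r * (k + 1) = r * (k + 1) + (k + 1)" by simp
    then show ?thesis by (simp only: upt_add_eq_append[OF le0])
  qed
  ultimately show ?case using Suc by (simp only: map_append)
qed simp

lemma hard_input_eq: "hard_input C \<epsilon> n1 k = exp_input (hard_rate C \<epsilon> n1 k) (n1 * (k + 1))"
  unfolding hard_input_def concat_replicate_block hard_rate_def ..

lemma sum_hard_rate:
  fixes g :: "real \<Rightarrow> real"
  shows "(\<Sum>i<n1 * (k + 1). g (hard_rate C \<epsilon> n1 k i)) = real n1 * (real k * g (hard_mu C \<epsilon> n1) + g (hard_lambda C \<epsilon>))"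
proof -
  have *: "sum_list (map g (concat (replicate r (replicate k u @ [v])))) = real r * (real k * g u + g v)" for r u v
    by (induction r) (auto simp: sum_list_replicate algebra_simps)
  have "(\<Sum>i<n1 * (k + 1). g (hard_rate C \<epsilon> n1 k i)) = sum_list (map g (map (hard_rate C \<epsilon> n1 k) [0..<n1 * (k + 1)]))"
    by (simp add: interv_sum_list_conv_sum_set_nat lessThan_atLeast0 o_def)
  also have "map (hard_rate C \<epsilon> n1 k) [0..<n1 * (k + 1)] =
      concat (replicate n1 (replicate k (hard_mu C \<epsilon> n1) @ [hard_lambda C \<epsilon>]))"
    unfolding concat_replicate_block hard_rate_def ..
  finally show ?thesis unfolding * .
qed

lemma is_rounding_bounds:
  assumes "is_rounding k r"
  shows "r \<le> real k + 1" "real k \<le> r + 1"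
  using assms unfolding is_rounding_def by linarith+

lemma hard_k_eq: "\<epsilon> \<noteq> 0 \<Longrightarrow> hard_k C \<epsilon> n1 = 18 * real n1 * (ln C)\<^sup>2"
  by (simp add: hard_k_def hard_mu_def hard_beta_def power2_eq_square)

context
  fixes C \<epsilon> :: real and n1 k :: nat
  assumes C: "1 \<le> C" and eps: "0 < \<epsilon>" "\<epsilon> < 1" and n1: "1 \<le> n1"
    and beta: "2 \<le> hard_beta C \<epsilon> n1" and k: "is_rounding k (hard_k C \<epsilon> n1)"
begin

lemma ln_C_pos: "0 < ln C"
proof (rule ccontr)
  assume "\<not> 0 < ln C"
  then have "ln C = 0" using ln_ge_zero[OF C] by simp
  then show False using beta by (simp add: hard_beta_def)
qed

lemma hard_lambda_gt: "ln C < hard_lambda C \<epsilon>"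
  using ln_C_pos eps by (simp add: hard_lambda_def)

lemma hard_lambda_le_mu: "hard_lambda C \<epsilon> \<le> hard_mu C \<epsilon> n1"
  unfolding hard_lambda_def hard_mu_def using ln_C_pos eps beta by (intro mult_right_mono) auto

lemma hard_rate_gt: "ln C < hard_rate C \<epsilon> n1 k i"
  using hard_lambda_gt hard_lambda_le_mu by (simp add: hard_rate_def)

text \<open>
  The risk \<open>exp (- (1 + \<epsilon>) * ln C * (1 - s))\<close> of a slow item stays within the budget
  \<open>1 / C = exp (- ln C)\<close> exactly while \<open>s \<le> \<epsilon> / (1 + \<epsilon>)\<close>.
\<close>

lemma overflow_prob_hard_lambda:
  assumes "\<epsilon> / (1 + \<epsilon>) < s"
  shows "1 / C < overflow_prob (expm (hard_lambda C \<epsilon>)) s"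
proof -
  have "\<epsilon> < (1 + \<epsilon>) * s" using assms eps by (simp add: field_simps)
  then have "(1 + \<epsilon>) * (1 - s) < 1" by (simp add: algebra_simps)
  then have "(1 + \<epsilon>) * (1 - s) * ln C < 1 * ln C" by (intro mult_strict_right_mono ln_C_pos)
  then have "hard_lambda C \<epsilon> * (1 - s) < ln C" by (simp add: hard_lambda_def mult_ac)
  then have "exp (- ln C) < exp (- hard_lambda C \<epsilon> * (1 - s))" by simp
  moreover have "1 / C = exp (- ln C)" using C by (simp add: exp_minus inverse_eq_divide)
  moreover have "exp (- ln C) < 1" using ln_C_pos by simp
  ultimately show ?thesis
    using hard_lambda_gt ln_C_pos by (subst overflow_prob_expm) auto
qed

text \<open>
  The sum exceeds the level \<open>\<epsilon> / (1 + \<epsilon>)\<close> for one of two reasons.  If \<open>\<epsilon> * ln C\<close> is small, the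
  slow item alone exceeds it with probability \<open>exp (- \<epsilon> * ln C)\<close>; in this range \<open>k\<close> may even be 0.
  Otherwise \<open>k \<ge> 4\<close>, and the fast items, with expected total about \<open>3 * \<epsilon>\<close>, exceed it by the
  Chernoff bound.
\<close>

lemma hard_block_prob:
  assumes b: "1 \<le> b" "b < n1"
  defines "M \<equiv> exp_sizes (hard_rate C \<epsilon> n1 k) (n1 * (k + 1))"
  shows "1 / 2 \<le> measure M {x \<in> space M. \<epsilon> / (1 + \<epsilon>) < (\<Sum>m\<in>{b * (k + 1) - 1..<b * (k + 1) + k}. x m)}"
proof -
  let ?rate = "hard_rate C \<epsilon> n1 k" and ?n = "n1 * (k + 1)" and ?\<theta> = "\<epsilon> / (1 + \<epsilon>)"
  have pos: "0 < ?rate i" for i using ln_C_pos hard_rate_gt[of i] by linarith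
  interpret prob_space M unfolding M_def by (rule prob_space_exp_sizes) (rule pos)
  have le: "Suc b * (k + 1) \<le> ?n" using b by (intro mult_le_mono1) auto
  have comp: "(\<lambda>x. x m) \<in> borel_measurable M" if "m < b * (k + 1) + k" for m
    unfolding M_def measurable_exp_sizes using le that by (intro measurable_component_singleton) auto
  have sum_meas: "(\<lambda>x. \<Sum>m\<in>J. x m) \<in> borel_measurable M" if "J \<subseteq> {..<b * (k + 1) + k}" for J
    using comp that by (intro borel_measurable_sum) auto
  have sum_sets: "{x \<in> space M. ?\<theta> < (\<Sum>m\<in>J. x m)} \<in> sets M" if "J \<subseteq> {..<b * (k + 1) + k}" for J
    using sum_meas[OF that] by measurable
  let ?all = "{b * (k + 1) - 1..<b * (k + 1) + k}"
  have reduce: "prob {x \<in> space M. ?\<theta> < (\<Sum>m\<in>J. x m)} \<le> prob {x \<in> space M. ?\<theta> < (\<Sum>m\<in>?all. x m)}"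
    if J: "J \<subseteq> ?all" for J
  proof (rule finite_measure_mono_AE)
    have "AE x in M. \<forall>i<?n. 0 \<le> x i" unfolding M_def by (rule AE_exp_sizes_nonneg[OF pos])
    then show "AE x in M. x \<in> {x \<in> space M. ?\<theta> < (\<Sum>m\<in>J. x m)} \<longrightarrow> x \<in> {x \<in> space M. ?\<theta> < (\<Sum>m\<in>?all. x m)}"
    proof (rule eventually_mono)
      fix x :: "nat \<Rightarrow> real" assume "\<forall>i<?n. 0 \<le> x i"
      then have "(\<Sum>m\<in>J. x m) \<le> (\<Sum>m\<in>?all. x m)"
        using J le by (intro sum_mono2) auto
      then show "x \<in> {x \<in> space M. ?\<theta> < (\<Sum>m\<in>J. x m)} \<longrightarrow> x \<in> {x \<in> space M. ?\<theta> < (\<Sum>m\<in>?all. x m)}"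
        by auto
    qed
  qed (rule sum_sets, auto)
  show ?thesis
  proof (cases "\<epsilon> * ln C \<le> 1 / 2")
    case True
    let ?i = "b * (k + 1) - 1"
    have "?i = (b - 1) * (k + 1) + k" using b by (cases b) auto
    then have "?i mod (k + 1) = k" by (simp only: mod_mult_self3) simp
    then have ri: "?rate ?i = hard_lambda C \<epsilon>" by (simp add: hard_rate_def)
    have i: "?i < ?n" and iall: "{?i} \<subseteq> ?all" using b le by (auto simp: algebra_simps)
    have "1 / 2 \<le> exp (- (1 / 2 :: real))" using exp_ge_add_one_self[of "- (1 / 2) :: real"] by simp
    also have "\<dots> \<le> exp (- (\<epsilon> * ln C))" using True by simp
    also have "\<epsilon> * ln C = ?rate ?i * ?\<theta>" using eps unfolding ri hard_lambda_def by (simp add: field_simps)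
    also have "exp (- (?rate ?i * ?\<theta>)) = prob {x \<in> space M. ?\<theta> < x ?i}"
      unfolding M_def using measure_exp_sizes_gt[OF pos i, of ?\<theta>] eps by simp
    also have "\<dots> \<le> prob {x \<in> space M. ?\<theta> < (\<Sum>m\<in>?all. x m)}"
      using reduce[OF iall] by simp
    finally show ?thesis .
  next
    case False
    let ?J = "{b * (k + 1)..<b * (k + 1) + k}"
    have "1 / 2 < ln C" using False eps ln_C_pos by (smt (verit) mult_less_cancel_right1)
    then have "(1 / 2)\<^sup>2 < (ln C)\<^sup>2" by (intro power_strict_mono) auto
    then have "18 * 1 * (1 / 2)\<^sup>2 < 18 * real n1 * (ln C)\<^sup>2"
      using n1 by (intro mult_le_less_imp_less) auto
    then have "4 < hard_k C \<epsilon> n1" using eps by (simp add: hard_k_eq power2_eq_square)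
    then have k4: "4 \<le> k" using k unfolding is_rounding_def by linarith
    have mu: "0 < hard_mu C \<epsilon> n1" using hard_lambda_le_mu hard_lambda_gt ln_C_pos by linarith
    have rJ: "?rate m = hard_mu C \<epsilon> n1" if "m \<in> ?J" for m
    proof -
      define i where "i = m - b * (k + 1)"
      have m: "m = b * (k + 1) + i" "i < k" using that by (auto simp: i_def)
      have "m mod (k + 1) = i" unfolding m(1) using m(2) by (subst mod_mult_self3) simp
      then show ?thesis using m by (simp add: hard_rate_def)
    qed
    have "hard_mu C \<epsilon> n1 * ?\<theta> \<le> hard_mu C \<epsilon> n1 * \<epsilon>"
      using mu eps by (intro mult_left_mono) (auto simp: divide_le_eq)
    also have "\<dots> = hard_k C \<epsilon> n1 / 3" by (simp add: hard_k_def)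
    also have "\<dots> \<le> real (k + 1) / 3" using is_rounding_bounds(1)[OF k] by simp
    finally have exponent: "hard_mu C \<epsilon> n1 * ?\<theta> \<le> real (k + 1) / 3" .
    have "exp (real (k + 1) / 3) \<le> 2 ^ (k - 1)"
    proof (rule power_le_imp_le_base)
      \<comment> \<open>Cubing removes the division by 3 and leaves integer powers to compare.\<close>
      have pw: "(3::real) ^ (r + 5) \<le> 8 ^ (r + 3)" for r
      proof (induction r)
        case (Suc r)
        then have "3 * (3::real) ^ (r + 5) \<le> 8 * 8 ^ (r + 3)" by (intro mult_mono) auto
        then show ?case by (simp only: add_Suc power_Suc)
      qed simp
      have "exp (real (k + 1) / 3) ^ Suc 2 = exp (real (k + 1))"
        by (simp flip: exp_of_nat_mult)
      also have "\<dots> = exp 1 ^ (k + 1)"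
        using exp_of_nat_mult[of "k + 1" "1 :: real"] by (simp only: mult_1_right)
      also have "\<dots> \<le> 3 ^ (k + 1)" by (intro power_mono exp_le) auto
      also have "\<dots> \<le> 8 ^ (k - 1)"
      proof -
        have "k + 1 = (k - 4) + 5" "k - 1 = (k - 4) + 3" using k4 by auto
        then show ?thesis using pw[of "k - 4"] by (simp only:)
      qed
      also have "\<dots> = (2 ^ (k - 1)) ^ Suc 2" by (simp flip: power_mult power_mult_distrib add: power_commutes mult.commute, simp add: power_mult)
      finally show "exp (real (k + 1) / 3) ^ Suc 2 \<le> (2 ^ (k - 1)) ^ Suc 2" .
    qed simp
    moreover have "(2::real) ^ k = 2 * 2 ^ (k - 1)" using k4 by (simp flip: power_Suc)
    moreover have "exp (hard_mu C \<epsilon> n1 * ?\<theta>) \<le> exp (real (k + 1) / 3)" using exponent by simp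
    ultimately have "exp (hard_mu C \<epsilon> n1 * ?\<theta>) \<le> 1 / 2 * 2 ^ k" by linarith
    then have "exp (hard_mu C \<epsilon> n1 * ?\<theta>) / 2 ^ k \<le> 1 / 2" by (subst pos_divide_le_eq) simp_all
    moreover have "prob {x \<in> space M. (\<Sum>m\<in>?J. x m) \<le> ?\<theta>} \<le> exp (hard_mu C \<epsilon> n1 * ?\<theta>) / 2 ^ k"
    proof -
      have "?J \<subseteq> {..<?n}" using le by auto
      from measure_exp_sizes_sum_le[OF pos this rJ mu, where a = ?\<theta>] show ?thesis
        unfolding M_def by (simp only: card_atLeastLessThan diff_add_inverse)
    qed
    ultimately have "prob {x \<in> space M. (\<Sum>m\<in>?J. x m) \<le> ?\<theta>} \<le> 1 / 2" by linarith
    moreover have "prob {x \<in> space M. ?\<theta> < (\<Sum>m\<in>?J. x m)} = 1 - prob {x \<in> space M. (\<Sum>m\<in>?J. x m) \<le> ?\<theta>}"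
    proof -
      have "{x \<in> space M. (\<Sum>m\<in>?J. x m) \<le> ?\<theta>} = space M - {x \<in> space M. ?\<theta> < (\<Sum>m\<in>?J. x m)}" by auto
      moreover have "?J \<subseteq> {..<b * (k + 1) + k}" by auto
      ultimately show ?thesis using prob_compl[OF sum_sets[of ?J]] by (simp only:)
    qed
    moreover have "?J \<subseteq> ?all" by auto
    ultimately show ?thesis using reduce[of ?J] by linarith
  qed
qed

lemma cost_greedy_hard_ge:
  "1 / 2 * real n1 \<le> cost C (hard_input C \<epsilon> n1 k) (budgeted_greedy newest_bin 1 C (hard_input C \<epsilon> n1 k))"
  unfolding hard_input_eq
proof (rule cost_greedy_blocks_ge[where lam = "hard_lambda C \<epsilon>" and \<theta> = "\<epsilon> / (1 + \<epsilon>)"])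
  show "0 < hard_lambda C \<epsilon>" using hard_lambda_gt ln_C_pos by linarith
  show "hard_lambda C \<epsilon> \<le> hard_rate C \<epsilon> n1 k i" for i using hard_lambda_le_mu by (simp add: hard_rate_def)
qed (use C n1 overflow_prob_hard_lambda hard_block_prob in \<open>auto simp: hard_rate_def\<close>)

lemma hard_input_in_exponential_inputs: "hard_input C \<epsilon> n1 k \<in> exponential_inputs"
proof -
  have "0 < hard_rate C \<epsilon> n1 k i" for i using hard_rate_gt[of i] ln_C_pos by linarith
  then show ?thesis unfolding hard_input_eq exponential_inputs_def
    using n1 by (intro CollectI exI[of _ "map (hard_rate C \<epsilon> n1 k) [0..<n1 * (k + 1)]"]) auto
qed

lemma one_le_opt_cost_hard: "1 \<le> opt_cost C (hard_input C \<epsilon> n1 k)"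
  unfolding hard_input_eq using n1 by (intro opt_cost_exp_input_bounds(1) C hard_rate_gt) auto

text \<open>
  The bound on the cost of packing by rates, where the summand is \<open>1 / (\<epsilon> * ln C)\<close> for slow items
  and \<open>1 / (\<mu> - ln C) \<le> 2 / \<mu>\<close> for fast ones.  It amounts to about \<open>2 + 4 * A\<close>, where \<open>48 * A\<close> is the
  claimed bound.  The additive 2, one unfinished bin per rate, is covered by \<open>48 * A\<close> unless \<open>A\<close> is
  small, and then the whole cost is below 3.
\<close>

lemma opt_cost_hard_le:
  assumes eL: "4 \<le> \<epsilon> * ln C"
  shows "opt_cost C (hard_input C \<epsilon> n1 k) \<le> max 3 (48 * real n1 * (3 * \<epsilon> + 1 / (\<epsilon> * ln C)))"
proof -
  let ?L = "ln C" and ?mu = "hard_mu C \<epsilon> n1"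
  define A where "A = real n1 * (3 * \<epsilon> + 1 / (\<epsilon> * ?L))"
  have "\<epsilon> * ?L \<le> 1 * ?L" using eps ln_C_pos by (intro mult_right_mono) auto
  then have L4: "4 \<le> ?L" using eL by linarith
  have mu_eq: "\<epsilon> * ?mu = 6 * (real n1 * ?L\<^sup>2)"
    using eps by (simp add: hard_mu_def hard_beta_def power2_eq_square)
  have "4 * ?L \<le> ?L * ?L" using L4 by (intro mult_right_mono) auto
  then have L2: "16 \<le> ?L\<^sup>2" "4 * ?L \<le> ?L\<^sup>2" using L4 unfolding power2_eq_square by linarith+
  have n1L: "1 * ?L\<^sup>2 \<le> real n1 * ?L\<^sup>2" using n1 by (intro mult_right_mono) auto
  have mu_pos: "0 < ?mu" using hard_lambda_le_mu hard_lambda_gt ln_C_pos by linarith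
  have "\<epsilon> * ?mu \<le> 1 * ?mu" using eps mu_pos by (intro mult_right_mono) auto
  then have mu_ge: "2 * ?L \<le> ?mu" using mu_eq n1L L2 L4 by linarith
  have inv_mu: "real n1 / ?mu \<le> 1 / 96"
  proof -
    have "?mu = 6 * (real n1 * ?L\<^sup>2) / \<epsilon>" using mu_eq eps by (simp add: field_simps)
    then have "real n1 / ?mu = \<epsilon> / (6 * ?L\<^sup>2)" using n1 by simp
    also have "\<dots> \<le> 1 / (6 * 16)" using L2 eps by (intro frac_le) auto
    finally show ?thesis by simp
  qed
  have "real k / (?mu - ?L) \<le> real k / (?mu / 2)"
    using mu_ge mu_pos ln_C_pos by (intro divide_left_mono mult_pos_pos) auto
  also have "\<dots> = 2 * real k / ?mu" by simp
  also have "\<dots> \<le> 2 * (3 * \<epsilon> * ?mu + 1) / ?mu"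
    using is_rounding_bounds(2)[OF k] mu_pos by (intro divide_right_mono) (auto simp: hard_k_def)
  also have "\<dots> = 6 * \<epsilon> + 2 / ?mu" using mu_pos by (simp add: field_simps)
  finally have fast: "real k / (?mu - ?L) \<le> 6 * \<epsilon> + 2 / ?mu" .
  have "card (hard_rate C \<epsilon> n1 k ` {..<n1 * (k + 1)}) \<le> card {hard_lambda C \<epsilon>, ?mu}"
    by (intro card_mono) (auto simp: hard_rate_def)
  also have "\<dots> \<le> 2" by (simp add: card_insert_if)
  finally have "opt_cost C (hard_input C \<epsilon> n1 k) \<le> 2 + 2 * (\<Sum>i<n1 * (k + 1). 1 / (hard_rate C \<epsilon> n1 k i - ?L))"
    unfolding hard_input_eq using n1
    by (intro order_trans[OF opt_cost_exp_input_bounds(2)[OF C hard_rate_gt]]) auto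
  also have "\<dots> = 2 + 2 * (real n1 * (real k / (?mu - ?L) + 1 / (\<epsilon> * ?L)))"
    using sum_hard_rate[of "\<lambda>v. 1 / (v - ?L)" C \<epsilon> n1 k]
    by (simp add: hard_lambda_def algebra_simps)
  also have "\<dots> \<le> 2 + 2 * (real n1 * (6 * \<epsilon> + 2 / ?mu + 1 / (\<epsilon> * ?L)))"
    using fast by (intro add_left_mono mult_left_mono add_right_mono) auto
  also have "\<dots> = 2 + 4 * (real n1 / ?mu) + (12 * (real n1 * \<epsilon>) + 2 * (real n1 * (1 / (\<epsilon> * ?L))))"
    by (simp add: algebra_simps)
  also have "\<dots> \<le> 2 + 4 / 96 + 4 * A"
  proof -
    have "0 \<le> real n1 * (1 / (\<epsilon> * ?L))" using eps ln_C_pos by simp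
    moreover have "A = 3 * (real n1 * \<epsilon>) + real n1 * (1 / (\<epsilon> * ?L))"
      by (simp add: A_def distrib_left)
    ultimately show ?thesis using inv_mu by linarith
  qed
  also have "\<dots> \<le> max 3 (48 * A)" by (simp add: max_def)
  finally show ?thesis by (simp add: A_def mult.assoc)
qed

end

text \<open>
  The choice of \<open>\<epsilon>\<close> balances the two terms: \<open>3 * \<epsilon> = 1 / (\<epsilon> * ln C) = sqrt (3 / ln C)\<close>.  The
  condition \<open>sqrt (ln C) \<le> n1\<close> makes the maximum with 3 irrelevant, and \<open>C \<ge> exp 48\<close> is \<open>4 \<le> \<epsilon> * ln C\<close> for this \<open>\<epsilon>\<close>.
\<close>

lemma hard_input_sqrt:
  assumes C: "exp 48 \<le> C" and eps: "\<epsilon> = sqrt (1 / (3 * ln C))"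
    and n1: "sqrt (ln C) \<le> real n1" and k: "is_rounding k (hard_k C \<epsilon> n1)"
  shows "hard_input C \<epsilon> n1 k \<in> exponential_inputs"
    and "1 / 2 * real n1 \<le> cost C (hard_input C \<epsilon> n1 k) (budgeted_greedy newest_bin 1 C (hard_input C \<epsilon> n1 k))"
    and "1 \<le> opt_cost C (hard_input C \<epsilon> n1 k)"
    and "opt_cost C (hard_input C \<epsilon> n1 k) \<le> 200 * (1 / sqrt (ln C)) * real n1"
    and "1 / 400 * sqrt (ln C) * opt_cost C (hard_input C \<epsilon> n1 k)
      \<le> cost C (hard_input C \<epsilon> n1 k) (budgeted_greedy newest_bin 1 C (hard_input C \<epsilon> n1 k))"
proof -
  define r where "r = sqrt (ln C)"
  have C0: "0 < C" using C by (rule less_le_trans[rotated]) simp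
  have L: "48 \<le> ln C" using C C0 by (simp add: ln_ge_iff)
  have r2: "ln C = r\<^sup>2" using L by (simp add: r_def)
  have r: "4 * sqrt 3 \<le> r"
    unfolding r_def using L by (intro real_le_rsqrt) (simp add: power_mult_distrib)
  have s3: "1 \<le> sqrt 3" "sqrt 3 \<le> 2" by (auto intro: real_le_lsqrt)
  have s33: "sqrt 3 * sqrt 3 = 3" by simp
  have rpos: "4 \<le> r" using r s3 by linarith
  have eps_r: "\<epsilon> = 1 / (sqrt 3 * r)" using rpos by (simp add: eps r2 real_sqrt_divide real_sqrt_mult)
  have "1 * 4 \<le> sqrt 3 * r" using s3 rpos by (intro mult_mono) auto
  then have e: "0 < \<epsilon>" "\<epsilon> < 1" unfolding eps_r by auto
  have eL: "\<epsilon> * ln C = r / sqrt 3" using rpos by (simp add: eps_r r2 power2_eq_square)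
  have C1: "1 \<le> C" using C by (rule order_trans[rotated]) simp
  have n1r: "r \<le> real n1" using n1 by (simp add: r_def)
  have n1': "1 \<le> n1" using n1r rpos by linarith
  have "1 * 48 \<le> real n1 * ln C" using n1' L by (intro mult_mono) auto
  then have b: "2 \<le> hard_beta C \<epsilon> n1" using e by (simp add: hard_beta_def le_divide_eq)
  note hyps = C1 e n1' b k
  show "hard_input C \<epsilon> n1 k \<in> exponential_inputs" by (rule hard_input_in_exponential_inputs[OF hyps])
  show ge: "1 / 2 * real n1 \<le> cost C (hard_input C \<epsilon> n1 k) (budgeted_greedy newest_bin 1 C (hard_input C \<epsilon> n1 k))"
    by (rule cost_greedy_hard_ge[OF hyps])
  show "1 \<le> opt_cost C (hard_input C \<epsilon> n1 k)" by (rule one_le_opt_cost_hard[OF hyps])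
  have "opt_cost C (hard_input C \<epsilon> n1 k) \<le> max 3 (48 * real n1 * (3 * \<epsilon> + 1 / (\<epsilon> * ln C)))"
    by (rule opt_cost_hard_le[OF hyps]) (use r s3 in \<open>simp add: eL le_divide_eq\<close>)
  also have "3 * \<epsilon> + 1 / (\<epsilon> * ln C) = 2 * sqrt 3 / r"
    unfolding eL unfolding eps_r using rpos s33 by (simp add: field_simps)
  also have "max 3 (48 * real n1 * (2 * sqrt 3 / r)) \<le> 200 * (1 / r) * real n1"
  proof -
    have "1 \<le> real n1 / r" using n1r rpos by simp
    moreover have "real n1 / r * sqrt 3 \<le> real n1 / r * 2" using s3 rpos by (intro mult_left_mono) auto
    moreover have "48 * real n1 * (2 * sqrt 3 / r) = 96 * (real n1 / r * sqrt 3)"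
      "200 * (1 / r) * real n1 = 200 * (real n1 / r)" by auto
    ultimately show ?thesis by linarith
  qed
  finally show opt: "opt_cost C (hard_input C \<epsilon> n1 k) \<le> 200 * (1 / sqrt (ln C)) * real n1" by (simp add: r_def)
  have "1 / 400 * r * opt_cost C (hard_input C \<epsilon> n1 k) \<le> 1 / 400 * r * (200 * (1 / r) * real n1)"
    using opt rpos L by (intro mult_left_mono) (auto simp: r_def)
  also have "\<dots> = 1 / 2 * real n1" using rpos by simp
  also note ge
  finally show "1 / 400 * sqrt (ln C) * opt_cost C (hard_input C \<epsilon> n1 k)
      \<le> cost C (hard_input C \<epsilon> n1 k) (budgeted_greedy newest_bin 1 C (hard_input C \<epsilon> n1 k))"
    by (simp add: r_def)
qed

lemma competitive_ratio_ge:
  assumes C: "exp 48 \<le> C"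
  shows "ereal (1 / 400 * sqrt (ln C)) \<le> competitive_ratio C exponential_inputs (budgeted_greedy newest_bin 1 C)"
proof -
  define \<epsilon> where "\<epsilon> = sqrt (1 / (3 * ln C))"
  define n1 where "n1 = nat \<lceil>sqrt (ln C)\<rceil>"
  define k where "k = nat \<lfloor>hard_k C \<epsilon> n1\<rfloor>"
  have C0: "0 < C" using C by (rule less_le_trans[rotated]) simp
  have L: "48 \<le> ln C" using C C0 by (simp add: ln_ge_iff)
  have "0 \<le> hard_k C \<epsilon> n1" using L by (simp add: \<epsilon>_def hard_k_eq)
  then have k: "is_rounding k (hard_k C \<epsilon> n1)" by (simp add: is_rounding_def k_def)
  have n1: "sqrt (ln C) \<le> real n1" by (simp add: n1_def real_nat_ceiling_ge)
  note hard = hard_input_sqrt[OF C \<epsilon>_def n1 k]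
  let ?D = "hard_input C \<epsilon> n1 k"
  have "1 / 400 * sqrt (ln C) \<le> cost C ?D (budgeted_greedy newest_bin 1 C ?D) / opt_cost C ?D"
    using hard(3,5) by (simp add: le_divide_eq)
  then have "ereal (1 / 400 * sqrt (ln C)) \<le> ereal (cost C ?D (budgeted_greedy newest_bin 1 C ?D) / opt_cost C ?D)"
    by simp
  also have "\<dots> \<le> competitive_ratio C exponential_inputs (budgeted_greedy newest_bin 1 C)"
    unfolding competitive_ratio_def by (rule SUP_upper[OF hard(1)])
  finally show ?thesis .
qed

theorem mainTheorem7:
  shows "\<exists>t. tie_breaking t \<and>
    (\<forall>(C::real) (\<epsilon>::real) (n1::nat) (k::nat).
       1 \<le> C \<longrightarrow> 0 < \<epsilon> \<longrightarrow> \<epsilon> < 1 \<longrightarrow> 1 \<le> n1 \<longrightarrow> 2 \<le> hard_beta C \<epsilon> n1 \<longrightarrow>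
       is_rounding k (hard_k C \<epsilon> n1) \<longrightarrow>
         hard_k C \<epsilon> n1 = 18 * real n1 * (ln C)\<^sup>2 \<and>
         cost C (hard_input C \<epsilon> n1 k) (budgeted_greedy t 1 C (hard_input C \<epsilon> n1 k))
           \<ge> 1/2 * real n1 \<and>
         (4 \<le> \<epsilon> * ln C \<longrightarrow>
            opt_cost C (hard_input C \<epsilon> n1 k)
              \<le> max 3 (48 * real n1 *
                   (hard_k C \<epsilon> n1 / (hard_beta C \<epsilon> n1 * ln C) + 1 / (\<epsilon> * ln C))) \<and>
            48 * real n1 * (hard_k C \<epsilon> n1 / (hard_beta C \<epsilon> n1 * ln C) + 1 / (\<epsilon> * ln C))
              = 48 * real n1 * (3 * \<epsilon> + 1 / (\<epsilon> * ln C)))) \<and>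
    (\<exists>K>0. \<exists>c>0. \<forall>\<^sub>F C in at_top. \<forall>\<epsilon> (n1::nat) (k::nat).
       \<epsilon> = sqrt (1 / (3 * ln C)) \<longrightarrow> sqrt (ln C) \<le> real n1 \<longrightarrow>
       is_rounding k (hard_k C \<epsilon> n1) \<longrightarrow>
         cost C (hard_input C \<epsilon> n1 k) (budgeted_greedy t 1 C (hard_input C \<epsilon> n1 k))
           \<ge> 1/2 * real n1 \<and>
         opt_cost C (hard_input C \<epsilon> n1 k) \<le> K * (1 / sqrt (ln C)) * real n1 \<and>
         cost C (hard_input C \<epsilon> n1 k) (budgeted_greedy t 1 C (hard_input C \<epsilon> n1 k))
           \<ge> c * sqrt (ln C) * opt_cost C (hard_input C \<epsilon> n1 k)) \<and>
    (\<exists>c>0. \<forall>\<^sub>F C in at_top.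
       competitive_ratio C exponential_inputs (budgeted_greedy t 1 C) \<ge> ereal (c * sqrt (ln C)))"
proof (intro exI[of _ newest_bin] conjI)
  show "tie_breaking newest_bin" by (rule tie_breaking_newest_bin)
next
  show "\<forall>(C::real) (\<epsilon>::real) (n1::nat) (k::nat).
       1 \<le> C \<longrightarrow> 0 < \<epsilon> \<longrightarrow> \<epsilon> < 1 \<longrightarrow> 1 \<le> n1 \<longrightarrow> 2 \<le> hard_beta C \<epsilon> n1 \<longrightarrow>
       is_rounding k (hard_k C \<epsilon> n1) \<longrightarrow>
         hard_k C \<epsilon> n1 = 18 * real n1 * (ln C)\<^sup>2 \<and>
         cost C (hard_input C \<epsilon> n1 k) (budgeted_greedy newest_bin 1 C (hard_input C \<epsilon> n1 k))
           \<ge> 1/2 * real n1 \<and>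
         (4 \<le> \<epsilon> * ln C \<longrightarrow>
            opt_cost C (hard_input C \<epsilon> n1 k)
              \<le> max 3 (48 * real n1 *
                   (hard_k C \<epsilon> n1 / (hard_beta C \<epsilon> n1 * ln C) + 1 / (\<epsilon> * ln C))) \<and>
            48 * real n1 * (hard_k C \<epsilon> n1 / (hard_beta C \<epsilon> n1 * ln C) + 1 / (\<epsilon> * ln C))
              = 48 * real n1 * (3 * \<epsilon> + 1 / (\<epsilon> * ln C)))"
  proof (intro allI impI)
    fix C \<epsilon> :: real and n1 k :: nat
    assume hyps: "1 \<le> C" "0 < \<epsilon>" "\<epsilon> < 1" "1 \<le> n1" "2 \<le> hard_beta C \<epsilon> n1" "is_rounding k (hard_k C \<epsilon> n1)"
    have "hard_k C \<epsilon> n1 / (hard_beta C \<epsilon> n1 * ln C) = 3 * \<epsilon>"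
      using ln_C_pos[OF hyps] hyps(5) by (simp add: hard_k_def hard_mu_def)
    then show "hard_k C \<epsilon> n1 = 18 * real n1 * (ln C)\<^sup>2 \<and>
         cost C (hard_input C \<epsilon> n1 k) (budgeted_greedy newest_bin 1 C (hard_input C \<epsilon> n1 k))
           \<ge> 1/2 * real n1 \<and>
         (4 \<le> \<epsilon> * ln C \<longrightarrow>
            opt_cost C (hard_input C \<epsilon> n1 k)
              \<le> max 3 (48 * real n1 *
                   (hard_k C \<epsilon> n1 / (hard_beta C \<epsilon> n1 * ln C) + 1 / (\<epsilon> * ln C))) \<and>
            48 * real n1 * (hard_k C \<epsilon> n1 / (hard_beta C \<epsilon> n1 * ln C) + 1 / (\<epsilon> * ln C))
              = 48 * real n1 * (3 * \<epsilon> + 1 / (\<epsilon> * ln C)))"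
      using hard_k_eq[of \<epsilon> C n1] cost_greedy_hard_ge[OF hyps] opt_cost_hard_le[OF hyps] hyps(2) by simp
  qed
next
  have "\<forall>\<^sub>F C in at_top. \<forall>\<epsilon> (n1::nat) (k::nat).
       \<epsilon> = sqrt (1 / (3 * ln C)) \<longrightarrow> sqrt (ln C) \<le> real n1 \<longrightarrow>
       is_rounding k (hard_k C \<epsilon> n1) \<longrightarrow>
         cost C (hard_input C \<epsilon> n1 k) (budgeted_greedy newest_bin 1 C (hard_input C \<epsilon> n1 k))
           \<ge> 1/2 * real n1 \<and>
         opt_cost C (hard_input C \<epsilon> n1 k) \<le> 200 * (1 / sqrt (ln C)) * real n1 \<and>
         cost C (hard_input C \<epsilon> n1 k) (budgeted_greedy newest_bin 1 C (hard_input C \<epsilon> n1 k))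
           \<ge> 1 / 400 * sqrt (ln C) * opt_cost C (hard_input C \<epsilon> n1 k)"
    by (rule eventually_mono[OF eventually_ge_at_top[of "exp 48"]]) (blast intro: hard_input_sqrt)
  then show "\<exists>K>0. \<exists>c>0. \<forall>\<^sub>F C in at_top. \<forall>\<epsilon> (n1::nat) (k::nat).
       \<epsilon> = sqrt (1 / (3 * ln C)) \<longrightarrow> sqrt (ln C) \<le> real n1 \<longrightarrow>
       is_rounding k (hard_k C \<epsilon> n1) \<longrightarrow>
         cost C (hard_input C \<epsilon> n1 k) (budgeted_greedy newest_bin 1 C (hard_input C \<epsilon> n1 k))
           \<ge> 1/2 * real n1 \<and>
         opt_cost C (hard_input C \<epsilon> n1 k) \<le> K * (1 / sqrt (ln C)) * real n1 \<and>
         cost C (hard_input C \<epsilon> n1 k) (budgeted_greedy newest_bin 1 C (hard_input C \<epsilon> n1 k))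
           \<ge> c * sqrt (ln C) * opt_cost C (hard_input C \<epsilon> n1 k)"
    by (intro exI[of _ 200] exI[of _ "1 / 400"] conjI) auto
next
  have "\<forall>\<^sub>F C in at_top.
       ereal (1 / 400 * sqrt (ln C)) \<le> competitive_ratio C exponential_inputs (budgeted_greedy newest_bin 1 C)"
    by (rule eventually_mono[OF eventually_ge_at_top[of "exp 48"]]) (rule competitive_ratio_ge)
  then show "\<exists>c>0. \<forall>\<^sub>F C in at_top.
       ereal (c * sqrt (ln C)) \<le> competitive_ratio C exponential_inputs (budgeted_greedy newest_bin 1 C)"
    by (intro exI[of _ "1 / 400"] conjI) auto
qed

end
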